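(* Let $n\geq 5$ be an integer. If $n$ is odd, then $$\operatorname{gr}_3(K_{1,3}:\widehat{K}_n)=\left\lfloor\frac{5n}{2}\right\rfloor,$$ and if $n$ is even, then $$\left\lfloor\frac{5n}{2}\right\rfloor-1\leq \operatorname{gr}_3(K_{1,3}:\widehat{K}_n)\leq \left\lfloor\frac{5n}{2}\right\rfloor.$$
   Context: The kipas $\widehat{K}_n$ is the graph on $n+1$ vertices obtained from the path $P_n$ on $n$ vertices by adding a new vertex (the center) adjacent to all vertices of the path. $K_{1,3}$ is the star with three edges. For graphs $G,H$ and a positive integer $k$, the Gallai-Ramsey number $\operatorname{gr}_k(G:H)$ is the minimum integer $N$ such that for every $n'\geq N$, every exact $k$-edge-coloring of the complete graph $K_{n'}$ (an edge-coloring in which exactly $k$ colors are used) contains either a rainbow copy of $G$ (a copy all of whose edges have pairwise distinct colors) or a monochromatic copy of $H$ (a copy all of whose edges have the same color). Copies are subgraphs, not necessarily induced; edge-colorings are not required to be proper. *)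

theory Defs
  imports Complex_Main "HOL-Library.Ramsey"
begin

text \<open>A finite simple graph is a pair of a vertex set and a set of two-element vertex sets.\<close>

type_synonym 'a graph = "'a set \<times> 'a set set"

abbreviation verts :: "'a graph \<Rightarrow> 'a set" where "verts \<equiv> fst"
abbreviation edges :: "'a graph \<Rightarrow> 'a set set" where "edges \<equiv> snd"

definition complete_graph :: "nat \<Rightarrow> nat graph" where
  "complete_graph m = ({..<m}, [{..<m}]\<^bsup>2\<^esup>)"

definition path_graph :: "nat \<Rightarrow> nat graph" where
  "path_graph n = ({1..n}, {{i, i + 1} | i. 1 \<le> i \<and> i < n})"

text \<open>Vertex 0 is the center, both of the star and of the kipas.\<close>

definition star_graph :: "nat \<Rightarrow> nat graph" where
  "star_graph r = ({0..r}, {{0, i} | i. i \<in> {1..r}})"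

definition kipas :: "nat \<Rightarrow> nat graph" where
  "kipas n = (insert 0 (verts (path_graph n)),
              edges (path_graph n) \<union> {{0, v} | v. v \<in> verts (path_graph n)})"

text \<open>A copy of \<open>G\<close> in \<open>H\<close> (as a subgraph, not necessarily induced) is given by an
  injective map of vertices that sends edges to edges.\<close>

definition is_copy :: "'a graph \<Rightarrow> 'b graph \<Rightarrow> ('a \<Rightarrow> 'b) \<Rightarrow> bool" where
  "is_copy G H f \<longleftrightarrow>
     inj_on f (verts G) \<and> f ` verts G \<subseteq> verts H \<and> (\<forall>e\<in>edges G. f ` e \<in> edges H)"

definition exact_edge_coloring :: "nat \<Rightarrow> 'a graph \<Rightarrow> ('a set \<Rightarrow> nat) \<Rightarrow> bool" where
  "exact_edge_coloring k H c \<longleftrightarrow> card (c ` edges H) = k"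

definition has_rainbow_copy :: "'a graph \<Rightarrow> 'b graph \<Rightarrow> ('b set \<Rightarrow> nat) \<Rightarrow> bool" where
  "has_rainbow_copy G H c \<longleftrightarrow>
     (\<exists>f. is_copy G H f \<and> inj_on (\<lambda>e. c (f ` e)) (edges G))"

definition has_monochromatic_copy :: "'a graph \<Rightarrow> 'b graph \<Rightarrow> ('b set \<Rightarrow> nat) \<Rightarrow> bool" where
  "has_monochromatic_copy G H c \<longleftrightarrow>
     (\<exists>f. is_copy G H f \<and> (\<exists>a. \<forall>e\<in>edges G. c (f ` e) = a))"

definition gallai_ramsey_bound :: "nat \<Rightarrow> 'a graph \<Rightarrow> 'b graph \<Rightarrow> nat \<Rightarrow> bool" where
  "gallai_ramsey_bound k G H N \<longleftrightarrow>
     (\<forall>m\<ge>N. \<forall>c. exact_edge_coloring k (complete_graph m) c \<longrightarrow>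
        has_rainbow_copy G (complete_graph m) c \<or> has_monochromatic_copy H (complete_graph m) c)"

definition gallai_ramsey :: "nat \<Rightarrow> 'a graph \<Rightarrow> 'b graph \<Rightarrow> nat" where
  "gallai_ramsey k G H = (LEAST N. gallai_ramsey_bound k G H N)"

end

theory Submission
  imports Defs "HOL-Library.Multiset"
begin

text \<open>
  Without a rainbow claw every vertex sees at most two of the three colours, so the vertices split
  into parts \<open>A\<close>, \<open>B\<close>, \<open>C\<close> that see only the colours \<open>{p, q}\<close>, \<open>{p, r}\<close>, \<open>{q, r}\<close>; all edges
  between two parts have the colour these share. If \<open>v \<in> A\<close> has \<open>d\<close> neighbours of colour \<open>p\<close> in \<open>A\<close>
  and colour \<open>p\<close> has minimum degree \<open>t\<close> in \<open>B\<close>, then by Dirac's argument at most two disjoint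
  \<open>p\<close>-paths in \<open>B\<close> have \<open>2 * t\<close> edges in total, and interleaving vertices of \<open>B\<close> with neighbours of \<open>v\<close>
  gives a \<open>p\<close>-path with \<open>2 * d + 2 * t + 1\<close> vertices in the \<open>p\<close>-neighbourhood of \<open>v\<close>. In the
  absence of a monochromatic kipas this bounds the degrees, and hence the number of vertices, as
  soon as all nonempty parts have more than \<open>n div 2\<close> vertices. Small parts are handled by the Ramsey numbers
  of a path versus a path and of a path versus a kipas.

  The extremal colouring has one part that is a clique on \<open>n\<close> vertices in colour 2, and another part in
  which colour 1 consists of three cliques with about \<open>n div 2\<close> vertices.
\<close>

section \<open>Long paths under a minimum degree condition\<close>

definition path_in :: "('a \<Rightarrow> 'a \<Rightarrow> bool) \<Rightarrow> 'a set \<Rightarrow> 'a list \<Rightarrow> bool" where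
  "path_in E X xs \<longleftrightarrow> distinct xs \<and> set xs \<subseteq> X \<and> successively E xs"

text \<open>The number \<open>n\<close> counts vertices, as in the path graph. Exact length costs
  nothing, since initial segments of paths are paths.\<close>

definition has_path :: "('a \<Rightarrow> 'a \<Rightarrow> bool) \<Rightarrow> 'a set \<Rightarrow> nat \<Rightarrow> bool" where
  "has_path E X n \<longleftrightarrow> (\<exists>xs. path_in E X xs \<and> length xs = n)"

definition nbrs :: "('a \<Rightarrow> 'a \<Rightarrow> bool) \<Rightarrow> 'a set \<Rightarrow> 'a \<Rightarrow> 'a set" where
  "nbrs E X v = {u \<in> X. E v u}"

definition has_kipas :: "('a \<Rightarrow> 'a \<Rightarrow> bool) \<Rightarrow> 'a set \<Rightarrow> nat \<Rightarrow> bool" where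
  "has_kipas E X n \<longleftrightarrow> (\<exists>v\<in>X. has_path E (nbrs E X v) n)"

lemma finite_nbrs [simp]: "finite X \<Longrightarrow> finite (nbrs E X v)"
  by (simp add: nbrs_def)

lemma nbrs_subset: "nbrs E X v \<subseteq> X"
  by (auto simp: nbrs_def)

lemma path_in_mono: "path_in E X xs \<Longrightarrow> X \<subseteq> Y \<Longrightarrow> path_in E Y xs"
  by (auto simp: path_in_def)

lemma path_in_take: "path_in E X xs \<Longrightarrow> path_in E X (take k xs)"
  unfolding path_in_def
  by (metis append_take_drop_id distinct_take order_trans set_take_subset successively_append_iff)

lemma path_in_length: "finite X \<Longrightarrow> path_in E X xs \<Longrightarrow> length xs \<le> card X"
  unfolding path_in_def by (metis card_mono distinct_card)

lemma has_path_mono: "has_path E X n \<Longrightarrow> X \<subseteq> Y \<Longrightarrow> m \<le> n \<Longrightarrow> has_path E Y m"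
  unfolding has_path_def
  by (metis length_take min.absorb2 path_in_mono path_in_take)

lemma has_pathI: "path_in E X xs \<Longrightarrow> n \<le> length xs \<Longrightarrow> has_path E X n"
  using has_path_mono[of E X "length xs" X n] by (auto simp: has_path_def)

lemma longest_path:
  assumes "finite X"
  obtains xs where "path_in E X xs" "\<And>ys. path_in E X ys \<Longrightarrow> length ys \<le> length xs"
proof -
  have "path_in E X []" by (simp add: path_in_def)
  moreover have "\<forall>ys. path_in E X ys \<longrightarrow> length ys < Suc (card X)"
    using path_in_length[OF assms] by (simp add: less_Suc_eq_le)
  ultimately have "\<exists>xs. path_in E X xs \<and> (\<forall>ys. path_in E X ys \<longrightarrow> length ys \<le> length xs)"
    by (rule ex_has_greatest_nat)
  then show thesis using that by blast
qed

text \<open>Otherwise \<open>u\<close> could be attached to that end, giving a longer path.\<close>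

lemma longest_path_ends:
  assumes "symp E" "path_in E X xs" "\<And>ys. path_in E X ys \<Longrightarrow> length ys \<le> length xs" "xs \<noteq> []"
    and "u \<in> X" "E (hd xs) u \<or> E (last xs) u"
  shows "u \<in> set xs"
proof (rule ccontr)
  assume u: "u \<notin> set xs"
  from assms(6) show False
  proof
    assume "E (hd xs) u"
    then have "path_in E X (u # xs)"
      using assms u by (auto simp: path_in_def successively_Cons dest: sympD)
    then show False using assms(3) by fastforce
  next
    assume "E (last xs) u"
    then have "path_in E X (xs @ [u])"
      using assms u by (auto simp: path_in_def successively_append_iff)
    then show False using assms(3) by fastforce
  qed
qed

text \<open>By maximality all neighbours of the first vertex lie on the path, and the first vertex
  is not among them.\<close>

lemma longest_path_length:
  assumes "finite X" "symp E" "irreflp E" "X \<noteq> {}" "\<And>v. v \<in> X \<Longrightarrow> d \<le> card (nbrs E X v)"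
    and "path_in E X xs" "\<And>ys. path_in E X ys \<Longrightarrow> length ys \<le> length xs"
  shows "d + 1 \<le> length xs"
proof -
  have ne: "xs \<noteq> []"
  proof
    assume "xs = []"
    obtain v where "v \<in> X" using assms by auto
    then have "path_in E X [v]" by (simp add: path_in_def)
    then show False using assms(7) \<open>xs = []\<close> by fastforce
  qed
  have "nbrs E X (hd xs) \<subseteq> set xs - {hd xs}"
    using longest_path_ends[OF assms(2,6,7) ne] \<open>irreflp E\<close> by (auto simp: nbrs_def irreflp_def)
  then have "card (nbrs E X (hd xs)) \<le> card (set xs - {hd xs})"
    by (intro card_mono) auto
  also have "\<dots> = length xs - 1"
    using assms(6) ne by (simp add: path_in_def distinct_card)
  finally have "card (nbrs E X (hd xs)) \<le> length xs - 1" .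
  moreover have "d \<le> card (nbrs E X (hd xs))"
    using assms(5)[of "hd xs"] assms(6) hd_in_set[OF ne] by (auto simp: path_in_def)
  moreover have "length xs > 0" using ne by simp
  ultimately show ?thesis by linarith
qed

text \<open>Dirac's argument: by counting, some edge \<open>{x, y}\<close> of the path has \<open>y\<close> adjacent to the
  first and \<open>x\<close> to the last vertex, so the vertices of the path lie on a cycle, and an edge
  leaving the cycle would give a longer path.\<close>

lemma dirac_closed:
  assumes "finite X" "symp E" "irreflp E" "\<And>v. v \<in> X \<Longrightarrow> d \<le> card (nbrs E X v)"
    and P: "path_in E X xs" and max: "\<And>ys. path_in E X ys \<Longrightarrow> length ys \<le> length xs"
    and len: "length xs \<le> 2 * d"
    and v: "v \<in> set xs" and u: "u \<in> X" "E v u"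
  shows "u \<in> set xs"
proof (rule ccontr)
  assume nu: "u \<notin> set xs"
  define p where "p = length xs"
  have ne: "xs \<noteq> []" using v by auto
  then have p0: "p > 0" by (simp add: p_def)
  have dx: "distinct xs" "set xs \<subseteq> X" "successively E xs" using P by (auto simp: path_in_def)
  note ends = longest_path_ends[OF assms(2) P max ne]
  \<comment> \<open>An index \<open>i\<close> stands for the edge from \<open>xs ! i\<close> to
    \<open>xs ! Suc i\<close>: \<open>I\<close> collects the edges whose second vertex is adjacent
    to the start, \<open>J\<close> those whose first vertex is adjacent to the end.\<close>
  define I where "I = {i. i < p - 1 \<and> E (xs ! 0) (xs ! Suc i)}"
  define J where "J = {i. i < p - 1 \<and> E (xs ! (p - 1)) (xs ! i)}"
  have IJ: "I \<subseteq> {..<p-1}" "J \<subseteq> {..<p-1}" by (auto simp: I_def J_def)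
  then have fin: "finite I" "finite J" by (auto intro: finite_subset)
  have irr: "\<not> E x x" for x using \<open>irreflp E\<close> by (auto simp: irreflp_def)
  have "nbrs E X (hd xs) \<subseteq> (\<lambda>i. xs ! Suc i) ` I"
  proof
    fix w assume "w \<in> nbrs E X (hd xs)"
    then have w: "w \<in> set xs" "E (hd xs) w" using ends by (auto simp: nbrs_def)
    then obtain j where j: "j < p" "w = xs ! j" by (auto simp: in_set_conv_nth p_def)
    have "j \<noteq> 0" using w j irr ne by (metis hd_conv_nth)
    then obtain i where "j = Suc i" using not0_implies_Suc by blast
    then show "w \<in> (\<lambda>i. xs ! Suc i) ` I" using j w ne by (auto simp: I_def hd_conv_nth)
  qed
  then have "card (nbrs E X (hd xs)) \<le> card I"
    using fin by (meson card_image_le card_mono finite_imageI le_trans)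
  then have cI: "d \<le> card I" using assms(4)[of "hd xs"] dx ne by (meson hd_in_set le_trans subsetD)
  have "nbrs E X (last xs) \<subseteq> (\<lambda>i. xs ! i) ` J"
  proof
    fix w assume "w \<in> nbrs E X (last xs)"
    then have w: "w \<in> set xs" "E (last xs) w" using ends by (auto simp: nbrs_def)
    then obtain j where j: "j < p" "w = xs ! j" by (auto simp: in_set_conv_nth p_def)
    have "j \<noteq> p - 1" using w j irr ne by (metis last_conv_nth p_def)
    then show "w \<in> (\<lambda>i. xs ! i) ` J" using j w ne by (auto simp: J_def last_conv_nth p_def)
  qed
  then have "card (nbrs E X (last xs)) \<le> card J"
    using fin by (meson card_image_le card_mono finite_imageI le_trans)
  then have cJ: "d \<le> card J" using assms(4)[of "last xs"] dx ne by (meson last_in_set le_trans subsetD)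
  \<comment> \<open>Both sets have at least \<open>d\<close> elements among
    \<open>p - 1 < 2 * d\<close> indices.\<close>
  have "I \<inter> J \<noteq> {}"
  proof
    assume "I \<inter> J = {}"
    then have "card I + card J = card (I \<union> J)" using fin by (simp add: card_Un_disjoint)
    also have "\<dots> \<le> p - 1" using IJ card_mono[of "{..<p-1}" "I \<union> J"] by auto
    finally show False using cI cJ len p0 unfolding p_def by linarith
  qed
  then obtain i where i: "i < p - 1" "E (xs ! 0) (xs ! Suc i)" "E (xs ! (p-1)) (xs ! i)"
    by (auto simp: I_def J_def)
  define as bs where "as = take (Suc i) xs" and "bs = drop (Suc i) xs"
  have ab: "xs = as @ bs" by (simp add: as_def bs_def)
  have nn: "as \<noteq> []" "bs \<noteq> []" using i ne by (auto simp: as_def bs_def p_def)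
  have hl: "hd as = xs ! 0" "last as = xs ! i" "hd bs = xs ! Suc i" "last bs = xs ! (p - 1)"
    subgoal using i ne by (simp add: as_def hd_conv_nth)
    subgoal using i by (simp add: as_def p_def take_Suc_conv_app_nth)
    subgoal using i by (simp add: bs_def p_def hd_drop_conv_nth)
    subgoal using nn(2) ne last_appendR[of bs as] by (simp add: ab[symmetric] last_conv_nth p_def)
    done
  \<comment> \<open>Following \<open>as\<close> forwards and \<open>bs\<close> backwards closes up
    to a cycle through the two chords given by \<open>i\<close>.\<close>
  define ys where "ys = as @ rev bs"
  have suc: "successively E as" "successively E bs" using dx ab by (auto simp: successively_append_iff)
  have sE: "E x y \<Longrightarrow> E y x" for x y using \<open>symp E\<close> by (auto dest: sympD)
  have srev: "successively E (rev bs)"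
    using suc by (simp add: successively_rev) (metis successively_mono sE)
  have ys: "distinct ys" "set ys = set xs" "successively E ys" "E (last ys) (hd ys)" "length ys = length xs"
    using dx(1) ab nn hl sE[OF i(2)] sE[OF i(3)] srev suc
    by (auto simp: ys_def successively_append_iff hd_rev last_rev)
  obtain as' bs' where cd: "ys = as' @ v # bs'" using v ys(2) by (metis split_list)
  \<comment> \<open>Cutting the cycle just before \<open>v\<close> and putting \<open>u\<close> in
    front gives the longer path.\<close>
  have "path_in E X (u # v # bs' @ as')"
    using ys dx(2) nu u(1) sE[OF u(2)] cd unfolding path_in_def
    by (auto simp: successively_Cons successively_append_iff split: if_splits)
  then have "length (u # v # bs' @ as') \<le> length xs" by (rule max)
  then show False using ys(5) cd by simp
qed

text \<open>No edge leaves a closed set, so after its deletion the degree condition still holds on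
  the rest.\<close>

lemma closed_compl_degree:
  assumes "symp E" "S \<subseteq> X" "\<And>v u. v \<in> S \<Longrightarrow> u \<in> X \<Longrightarrow> E v u \<Longrightarrow> u \<in> S" "v \<in> X - S"
  shows "nbrs E (X - S) v = nbrs E X v"
proof -
  have "u \<notin> S" if "E v u" "u \<in> X" for u
    using assms that by (metis DiffD1 DiffD2 sympD)
  then show ?thesis using assms(2) by (auto simp: nbrs_def)
qed

lemma card_nbrs_less:
  assumes "finite X" "irreflp E" "v \<in> X"
  shows "card (nbrs E X v) + 1 \<le> card X"
proof -
  have "nbrs E X v \<subset> X" using assms by (auto simp: nbrs_def irreflp_def)
  then have "card (nbrs E X v) < card X" by (rule psubset_card_mono[OF assms(1)])
  then show ?thesis by simp
qed

text \<open>If the longest path missed a vertex, it would span a closed set, and both this set and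
  its complement would have at least \<open>d + 1\<close> vertices, \<open>2 * d + 2\<close> in
  all.\<close>

lemma dirac_hamiltonian_path:
  assumes "finite X" "symp E" "irreflp E" "\<And>v. v \<in> X \<Longrightarrow> d \<le> card (nbrs E X v)"
    and "card X \<le> 2 * d + 1"
  shows "has_path E X (card X)"
proof -
  obtain xs where xs: "path_in E X xs" "\<And>ys. path_in E X ys \<Longrightarrow> length ys \<le> length xs"
    using longest_path[OF assms(1)] by metis
  show ?thesis
  proof (cases "length xs \<ge> card X")
    case True then show ?thesis using xs by (auto intro: has_pathI)
  next
    case False
    then have len: "length xs \<le> 2 * d" using assms(5) by linarith
    have sub: "set xs \<subseteq> X" "distinct xs" using xs by (auto simp: path_in_def)
    define Y where "Y = X - set xs"
    have cY: "card Y = card X - length xs" using sub assms(1)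
      by (simp add: Y_def card_Diff_subset distinct_card)
    then obtain y where y: "y \<in> Y" using False by (metis card.empty diff_is_0_eq ex_in_conv)
    have "nbrs E Y y = nbrs E X y"
      using closed_compl_degree[OF assms(2) sub(1)] dirac_closed[OF assms(1-4) xs len] y
      unfolding Y_def by metis
    then have "d + 1 \<le> card Y"
      using card_nbrs_less[of Y E y] assms(1,3) assms(4)[of y] y by (simp add: Y_def)
    moreover have "d + 1 \<le> length xs"
      using longest_path_length[OF assms(1-3) _ assms(4) xs] y by (auto simp: Y_def)
    ultimately show ?thesis using cY assms(5) by linarith
  qed
qed

text \<open>Distinctness of the concatenation says at once that no list repeats a vertex and that
  the lists are disjoint; its length counts the covered vertices.\<close>

definition path_system :: "('a \<Rightarrow> 'a \<Rightarrow> bool) \<Rightarrow> 'a set \<Rightarrow> 'a list list \<Rightarrow> bool" where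
  "path_system E X Ls \<longleftrightarrow> distinct (concat Ls) \<and> set (concat Ls) \<subseteq> X \<and>
     (\<forall>L\<in>set Ls. L \<noteq> [] \<and> successively E L)"

text \<open>A surplus of \<open>2 * d\<close> vertices over the number of paths means
  \<open>2 * d\<close> edges. If the longest path has fewer, it spans a closed set, and it and a
  longest path of the remainder supply at least \<open>d\<close> edges each.\<close>

lemma dirac_path_system:
  assumes "finite X" "X \<noteq> {}" "symp E" "irreflp E" "\<And>v. v \<in> X \<Longrightarrow> d \<le> card (nbrs E X v)"
  obtains Ls where "path_system E X Ls" "length Ls \<le> 2"
    "min (card X) (length Ls + 2 * d) \<le> length (concat Ls)"
proof (cases "card X \<le> 2 * d + 1")
  case True
  obtain xs where xs: "path_in E X xs" "length xs = card X"
    using dirac_hamiltonian_path[OF assms(1,3,4,5) True] by (auto simp: has_path_def)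
  have "xs \<noteq> []" using xs assms by auto
  then show ?thesis using xs by (intro that[of "[xs]"]) (auto simp: path_system_def path_in_def)
next
  case False
  obtain xs where xs: "path_in E X xs" "\<And>ys. path_in E X ys \<Longrightarrow> length ys \<le> length xs"
    using longest_path[OF assms(1)] by metis
  have lx: "d + 1 \<le> length xs"
    using longest_path_length[OF assms(1,3,4,2,5) xs] .
  show ?thesis
  proof (cases "2 * d + 1 \<le> length xs")
    case True
    then show ?thesis using xs by (intro that[of "[xs]"]) (auto simp: path_system_def path_in_def)
  next
    case F2: False
    then have len: "length xs \<le> 2 * d" by linarith
    have sub: "set xs \<subseteq> X" "distinct xs" using xs by (auto simp: path_in_def)
    define Y where "Y = X - set xs"
    have "card Y = card X - length xs" using sub assms(1)
      by (simp add: Y_def card_Diff_subset distinct_card)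
    then have "card Y > 0" using False len by linarith
    then have Y: "Y \<noteq> {}" "finite Y" by (auto simp: card_gt_0_iff)
    have deg: "d \<le> card (nbrs E Y y)" if "y \<in> Y" for y
    proof -
      have "nbrs E Y y = nbrs E X y"
        using closed_compl_degree[OF assms(3) sub(1)] dirac_closed[OF assms(1,3,4,5) xs len] that
        unfolding Y_def by metis
      then show ?thesis using assms(5)[of y] that by (simp add: Y_def)
    qed
    obtain ys where ys: "path_in E Y ys" "\<And>zs. path_in E Y zs \<Longrightarrow> length zs \<le> length ys"
      using longest_path[OF Y(2)] by metis
    have ly: "d + 1 \<le> length ys"
      using longest_path_length[OF Y(2) assms(3,4) Y(1) deg ys] .
    show ?thesis using xs ys lx ly
      by (intro that[of "[xs, ys]"]) (auto simp: path_system_def path_in_def Y_def)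
  qed
qed

section \<open>Joining paths and the path Ramsey number\<close>

text \<open>The number of paths is raised by one at a time: an uncovered vertex becomes a new path,
  and if all vertices are covered, a path is cut in two.\<close>

lemma path_system_extend:
  assumes "finite X" "path_system E X Ls" "min (card X) (e + length Ls) \<le> length (concat Ls)"
    and "length Ls \<le> k" "k \<le> card X"
  shows "\<exists>Ms. path_system E X Ms \<and> length Ms = k \<and> min (card X) (e + k) \<le> length (concat Ms)"
  using assms(4,5)
proof (induction k rule: dec_induct)
  case base
  then show ?case using assms by blast
next
  case (step k)
  then obtain Ms where Ms: "path_system E X Ms" "length Ms = k"
    "min (card X) (e + k) \<le> length (concat Ms)" by auto
  have sub: "set (concat Ms) \<subseteq> X" "distinct (concat Ms)" "\<And>L. L \<in> set Ms \<Longrightarrow> L \<noteq> [] \<and> successively E L"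
    using Ms(1) by (auto simp: path_system_def)
  show ?case
  proof (cases "set (concat Ms) = X")
    case False
    then obtain u where "u \<in> X" "u \<notin> set (concat Ms)" using sub by blast
    then show ?thesis using Ms
      by (intro exI[of _ "[u] # Ms"]) (auto simp: path_system_def)
  next
    case True
    then have len: "length (concat Ms) = card X" using sub(2) distinct_card by metis
    \<comment> \<open>Here \<open>k\<close> paths cover more than \<open>k\<close> vertices, so some
      path has an edge to cut.\<close>
    have "\<exists>L\<in>set Ms. length L \<ge> 2"
    proof (rule ccontr)
      assume "\<not> ?thesis"
      then have "\<And>L. L \<in> set Ms \<Longrightarrow> length L \<le> 1" by fastforce
      then have "sum_list (map length Ms) \<le> sum_list (map (\<lambda>_. 1) Ms)"
        by (intro sum_list_mono) auto
      then show False using len Ms(2) step by (simp add: length_concat sum_list_triv)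
    qed
    then obtain L where L: "L \<in> set Ms" "length L \<ge> 2" by blast
    then obtain x y zs where "L = x # y # zs" by (metis Suc_le_length_iff numeral_2_eq_2)
    moreover obtain as bs where "Ms = as @ L # bs" using L by (meson split_list)
    ultimately have split: "Ms = as @ (x # y # zs) # bs" by simp
    define Ns where "Ns = as @ [x] # (y # zs) # bs"
    have "concat Ns = concat Ms" "length Ns = Suc k" using split Ms by (auto simp: Ns_def)
    moreover have "\<forall>L\<in>set Ns. L \<noteq> [] \<and> successively E L"
      using sub(3)[of "x # y # zs"] sub(3) by (auto simp: Ns_def split)
    ultimately have "path_system E X Ns" "length Ns = Suc k" "length (concat Ns) = card X"
      using Ms(1) len by (auto simp only: path_system_def)
    then show ?thesis by auto
  qed
qed

text \<open>Used with one more list than vertices, so that every vertex sits between two lists and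
  the catch-all clause emits the last list.\<close>

fun interleave :: "'a list \<Rightarrow> 'a list list \<Rightarrow> 'a list" where
  "interleave (x # xs) (L # Ls) = L @ x # interleave xs Ls"
| "interleave xs Ls = concat Ls"

text \<open>The head and nonemptiness are part of the claim because the induction attaches
  \<open>x\<close> to the start of the remaining path.\<close>

lemma path_in_interleave:
  assumes "symp E" "X \<inter> B = {}" "\<And>x b. x \<in> X \<Longrightarrow> b \<in> B \<Longrightarrow> E x b"
    and "distinct xs" "set xs \<subseteq> X" "path_system E B Ls" "length Ls = length xs + 1"
  shows "path_in E (X \<union> B) (interleave xs Ls) \<and> length (interleave xs Ls) = length xs + length (concat Ls)
    \<and> set (interleave xs Ls) = set xs \<union> set (concat Ls) \<and> hd (interleave xs Ls) = hd (hd Ls)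
    \<and> interleave xs Ls \<noteq> []"
  using assms(4-)
proof (induction xs arbitrary: Ls)
  case Nil
  then obtain L where "Ls = [L]" by (auto simp: length_Suc_conv)
  with Nil show ?case by (auto simp: path_in_def path_system_def)
next
  case (Cons x xs)
  then obtain L Ms where Ls: "Ls = L # Ms" "length Ms = length xs + 1" by (cases Ls) auto
  then obtain M Ns where Ms: "Ms = M # Ns" by (cases Ms) auto
  have Ms': "path_system E B Ms" "distinct xs" "set xs \<subseteq> X" using Cons.prems Ls by (auto simp: path_system_def)
  note IH = Cons.IH[OF Ms'(2,3,1) Ls(2)]
  have L: "L \<noteq> []" "set L \<subseteq> B" "successively E L" "distinct L" "set L \<inter> set (concat Ms) = {}"
    using Cons.prems Ls by (auto simp: path_system_def)
  have M: "M \<noteq> []" "set M \<subseteq> B" using Cons.prems Ls Ms by (auto simp: path_system_def)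
  have x: "x \<in> X" "x \<notin> set xs" using Cons.prems by auto
  have "E (last L) x" using assms(1,3) x(1) L(1,2) by (metis last_in_set subsetD sympD)
  moreover have "E x (hd M)" using assms(3) x(1) M by (metis hd_in_set subsetD)
  moreover have "x \<notin> B" "set L \<inter> set xs = {}" "set (concat Ms) \<subseteq> B"
    using x(1) assms(2) L(2) Ms' by (auto simp: path_system_def)
  ultimately show ?case using IH L x M Ls Ms
    by (auto simp: path_in_def successively_append_iff successively_Cons)
qed

text \<open>The number \<open>e\<close> stands for the edges inside \<open>B\<close>. The system is
  spread to \<open>d + 1\<close> paths, and \<open>d\<close> vertices of \<open>X\<close> fill the
  gaps between them.\<close>

lemma join_path:
  assumes "finite X" "finite B" "symp E" "X \<inter> B = {}" "\<And>x b. x \<in> X \<Longrightarrow> b \<in> B \<Longrightarrow> E x b"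
    and "path_system E B Ls" "length Ls \<le> d + 1" "min (card B) (e + length Ls) \<le> length (concat Ls)"
    and "d \<le> card X" "d + 1 \<le> card B" "n \<le> d + card B" "n \<le> 2 * d + 1 + e"
  shows "has_path E (X \<union> B) n"
proof -
  obtain Ms where Ms: "path_system E B Ms" "length Ms = d + 1" "min (card B) (e + (d + 1)) \<le> length (concat Ms)"
    using path_system_extend[OF assms(2,6,8,7,10)] by auto
  obtain S where S: "S \<subseteq> X" "card S = d" "finite S" using obtain_subset_with_card_n[OF assms(9)] by metis
  obtain xs where xs: "set xs = S" "distinct xs" using finite_distinct_list[OF S(3)] by auto
  have lx: "length xs = d" using xs S distinct_card by metis
  have "path_in E (X \<union> B) (interleave xs Ms)" "length (interleave xs Ms) = length xs + length (concat Ms)"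
    using path_in_interleave[OF assms(3,4,5) xs(2) _ Ms(1)] Ms(2) lx xs S by auto
  moreover have "n \<le> length xs + length (concat Ms)" using Ms lx assms by linarith
  ultimately show ?thesis by (intro has_pathI) auto
qed

text \<open>Starting from the empty system, single vertices of \<open>B\<close> suffice, and the
  path alternates.\<close>

corollary join_path_simple:
  assumes "finite X" "finite B" "symp E" "X \<inter> B = {}" "\<And>x b. x \<in> X \<Longrightarrow> b \<in> B \<Longrightarrow> E x b"
    and "d \<le> card X" "d + 1 \<le> card B" "n \<le> 2 * d + 1"
  shows "has_path E (X \<union> B) n"
  by (rule join_path[where d = d and e = 0 and Ls = "[]", OF assms(1-5)])
    (use assms in \<open>auto simp: path_system_def\<close>)

section \<open>Ramsey numbers of a path against a path and against a kipas\<close>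

lemma mset_concat_eq: "mset Ls = mset Ms \<Longrightarrow> mset (concat Ls) = mset (concat Ms)"
  by (metis mset_concat mset_map sum_mset_sum_list)

lemma path_system_mset:
  assumes "mset Ls = mset Ms"
  shows "path_system E X Ls = path_system E X Ms"
proof -
  have "mset (concat Ls) = mset (concat Ms)" using assms by (rule mset_concat_eq)
  moreover have "set Ls = set Ms" using assms by (rule mset_eq_setD)
  ultimately show ?thesis unfolding path_system_def
    by (metis mset_eq_imp_distinct_iff mset_eq_setD)
qed

text \<open>By pigeonhole, two of any three vertices adjacent to \<open>y\<close> or \<open>z\<close> have
  one of them as a common neighbour.\<close>

lemma path_system_merge:
  assumes "symp F" "path_system F Y Ls" "3 \<le> length Ls" "y \<in> Y" "z \<in> Y"
    and "y \<notin> set (concat Ls)" "z \<notin> set (concat Ls)"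
    and ends: "\<And>L. L \<in> set Ls \<Longrightarrow> hd L \<in> U \<and> last L \<in> U"
    and adj: "\<And>u. u \<in> U \<Longrightarrow> F u y \<or> F u z"
  shows "\<exists>Ms. path_system F Y Ms \<and> Suc (length Ms) = length Ls \<and>
    length (concat Ms) = Suc (length (concat Ls)) \<and>
    set (concat Ms) \<subseteq> insert y (insert z (set (concat Ls))) \<and>
    (\<forall>L\<in>set Ms. hd L \<in> U \<and> last L \<in> U)"
proof -
  obtain a b c rest where Ls: "Ls = a # b # c # rest"
    using assms(3) by (metis Suc_le_length_iff numeral_3_eq_3)
  have "F (hd a) y \<or> F (hd a) z" "F (hd b) y \<or> F (hd b) z" "F (hd c) y \<or> F (hd c) z"
    using adj ends Ls by auto
  then obtain w where w: "w \<in> {y, z}"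
    "F (hd a) w \<and> F (hd b) w \<or> F (hd a) w \<and> F (hd c) w \<or> F (hd b) w \<and> F (hd c) w" by blast
  \<comment> \<open>The order of the system is immaterial, so two paths starting at neighbours of
    \<open>w\<close> may be moved to the front.\<close>
  have "\<exists>s t rs. mset (s # t # rs) = mset Ls \<and> F (hd s) w \<and> F (hd t) w"
    using w(2)
  proof (elim disjE conjE)
    assume "F (hd a) w" "F (hd b) w"
    then show ?thesis by (intro exI[of _ a] exI[of _ b] exI[of _ "c # rest"]) (simp add: Ls)
  next
    assume "F (hd a) w" "F (hd c) w"
    then show ?thesis by (intro exI[of _ a] exI[of _ c] exI[of _ "b # rest"]) (simp add: Ls add_mset_commute)
  next
    assume "F (hd b) w" "F (hd c) w"
    then show ?thesis by (intro exI[of _ b] exI[of _ c] exI[of _ "a # rest"]) (simp add: Ls add_mset_commute)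
  qed
  then obtain s t rs where st: "mset (s # t # rs) = mset Ls" "F (hd s) w" "F (hd t) w" by blast
  have ps: "path_system F Y (s # t # rs)" using path_system_mset[OF st(1)] assms(2) by blast
  have sL: "set (s # t # rs) = set Ls" using st(1) by (rule mset_eq_setD)
  then have sc: "set (concat (s # t # rs)) = set (concat Ls)" by (simp only: set_concat)
  have wn: "w \<notin> set (concat (s # t # rs))" "w \<in> Y" using w(1) assms(4-7) sc by auto
  have nn: "s \<noteq> []" "t \<noteq> []" using ps by (auto simp: path_system_def)
  have e: "\<And>L. L \<in> set (s # t # rs) \<Longrightarrow> hd L \<in> U \<and> last L \<in> U" using ends sL by blast
  have "mset (concat (s # t # rs)) = mset (concat Ls)"
    using st(1) by (rule mset_concat_eq)
  then have lc: "length (concat (s # t # rs)) = length (concat Ls)" by (metis size_mset)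
  have ll: "length (s # t # rs) = length Ls" using st(1) by (metis size_mset)
  have "successively F s" "successively F t" using ps by (auto simp: path_system_def)
  then have "successively F (rev s)"
    using assms(1) by (simp add: successively_rev) (metis successively_mono sympD)
  moreover have "F w (hd t)" using st(3) assms(1) by (metis sympD)
  \<comment> \<open>Reversing \<open>s\<close> brings its first vertex next to \<open>w\<close>; the
    ends of the new path are the last vertices of \<open>s\<close> and \<open>t\<close>, still in
    \<open>U\<close>.\<close>
  ultimately have "path_system F Y ((rev s @ w # t) # rs)"
    using ps wn st(2) nn by (auto simp: path_system_def successively_append_iff successively_Cons last_rev)
  moreover have "hd (rev s @ w # t) \<in> U" "last (rev s @ w # t) \<in> U" using e nn by (auto simp: hd_rev)
  ultimately show ?thesis using ll lc sc w(1) e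
    by (intro exI[of _ "(rev s @ w # t) # rs"]) auto
qed

text \<open>A vertex outside a longest \<open>E\<close>-path is \<open>F\<close>-adjacent to both ends of the path and to one
  vertex of each of its edges. So the disjoint edges \<open>{x\<^sub>1, x\<^sub>2}\<close>, \<open>{x\<^sub>3, x\<^sub>4}\<close>, \<dots> of the path
  serve to merge the outside vertices into two \<open>F\<close>-paths, which the ends then link up.\<close>

lemma long_path_other_colour:
  assumes "finite X" "symp E" "symp F" and EF: "\<And>u v. u \<in> X \<Longrightarrow> v \<in> X \<Longrightarrow> u \<noteq> v \<Longrightarrow> E u v \<or> F u v"
    and P: "path_in E X xs" and max: "\<And>ys. path_in E X ys \<Longrightarrow> length ys \<le> length xs"
    and len: "2 \<le> length xs" "length xs + length xs div 2 + 1 \<le> card X"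
  shows "has_path F X (length xs + 1)"
proof -
  define p r where "p = length xs" and "r = p div 2"
  have r: "1 \<le> r" "2 * r \<le> p" "p \<le> 2 * r + 1" using len by (auto simp: r_def p_def)
  define U where "U = X - set xs"
  have dx: "distinct xs" "set xs \<subseteq> X" "successively E xs" using P by (auto simp: path_in_def)
  have ne: "xs \<noteq> []" using len by auto
  have "card U = card X - p" using dx assms(1) by (simp add: U_def card_Diff_subset distinct_card p_def)
  then have "r + 1 \<le> card U" using len r_def p_def by linarith
  then obtain S where S: "S \<subseteq> U" "card S = r + 1" "finite S" using obtain_subset_with_card_n by metis
  obtain us where us: "set us = S" "distinct us" using finite_distinct_list[OF S(3)] by auto
  have lus: "length us = r + 1" using us S distinct_card by metis
  have ends: "F u (hd xs)" "F u (last xs)" if "u \<in> U" for u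
    using longest_path_ends[OF assms(2) P max ne, of u] EF[of u "hd xs"] EF[of u "last xs"] that ne dx(2)
      hd_in_set[OF ne] last_in_set[OF ne] \<open>symp E\<close> unfolding U_def by (metis DiffD1 DiffD2 subsetD sympD)+
  \<comment> \<open>Otherwise \<open>u\<close> could be inserted into this edge of the
    \<open>E\<close>-path and lengthen it.\<close>
  have pair: "F u (xs ! i) \<or> F u (xs ! Suc i)" if "u \<in> U" "Suc i < p" for u i
  proof (rule ccontr)
    assume no: "\<not> ?thesis"
    have u: "u \<in> X" "u \<notin> set xs" using that by (auto simp: U_def)
    have i: "i < length xs" "Suc i < length xs" using that by (auto simp: p_def)
    have "xs ! i \<in> set xs" "xs ! Suc i \<in> set xs" using i by auto
    then have "E u (xs ! i)" "E u (xs ! Suc i)" using no EF u dx by (metis subsetD)+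
    then have E: "E (xs ! i) u" "E u (xs ! Suc i)" using \<open>symp E\<close> by (auto dest: sympD)
    have split: "xs = take (Suc i) xs @ drop (Suc i) xs" by simp
    have "successively E (take (Suc i) xs)" "successively E (drop (Suc i) xs)"
      using dx(3) split by (metis successively_append_iff)+
    moreover have "last (take (Suc i) xs) = xs ! i" using i by (simp add: take_Suc_conv_app_nth)
    moreover have "hd (drop (Suc i) xs) = xs ! Suc i" using i by (simp add: hd_drop_conv_nth)
    ultimately have "successively E (take (Suc i) xs @ u # drop (Suc i) xs)"
      using E by (auto simp: successively_append_iff successively_Cons)
    moreover have "mset (take (Suc i) xs @ u # drop (Suc i) xs) = mset (u # xs)"
      by (subst (3) split) (simp only: mset_append mset.simps union_mset_add_mset_right)
    ultimately have "path_in E X (take (Suc i) xs @ u # drop (Suc i) xs)"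
      using u dx unfolding path_in_def
      by (metis distinct.simps(2) insert_subset list.simps(15) mset_eq_imp_distinct_iff mset_eq_setD)
    then show False using max i by fastforce
  qed
  \<comment> \<open>The two ends of \<open>xs\<close> are held back for the final linking.\<close>
  define Y where "Y = X - {xs ! 0, xs ! (p - 1)}"
  \<comment> \<open>After \<open>j\<close> merges, \<open>r + 1 - j\<close> paths cover
    \<open>r + 1 + j\<close> vertices, and at most the positions \<open>1\<close> to
    \<open>2 * j\<close> of \<open>xs\<close> have been used.\<close>
  have "\<exists>Ls. path_system F Y Ls \<and> length Ls + j = r + 1 \<and> length (concat Ls) = r + 1 + j \<and>
      set (concat Ls) \<subseteq> U \<union> (!) xs ` {1..2*j} \<and> (\<forall>L\<in>set Ls. hd L \<in> U \<and> last L \<in> U)" if "j \<le> r - 1" for j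
    using that
  proof (induction j)
    case 0
    have "xs ! 0 \<in> set xs" "xs ! (p - 1) \<in> set xs" using ne by (auto simp: p_def)
    then have "S \<subseteq> Y" using S(1) by (auto simp: U_def Y_def)
    then have "path_system F Y (map (\<lambda>u. [u]) us)" using us by (auto simp: path_system_def)
    then show ?case using us lus S(1) by (intro exI[of _ "map (\<lambda>u. [u]) us"]) auto
  next
    case (Suc j)
    then obtain Ls where Ls: "path_system F Y Ls" "length Ls + j = r + 1" "length (concat Ls) = r + 1 + j"
      "set (concat Ls) \<subseteq> U \<union> (!) xs ` {1..2*j}" "\<And>L. L \<in> set Ls \<Longrightarrow> hd L \<in> U \<and> last L \<in> U" by auto
    have j: "2 * j + 2 < p - 1" using Suc.prems r by linarith
    define y z where "y = xs ! (2*j+1)" and "z = xs ! (2*j+2)"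
    have new: "xs ! i \<in> Y \<and> xs ! i \<notin> set (concat Ls)" if "i \<in> {2*j+1, 2*j+2}" for i
    proof -
      have i: "0 < i" "i < p - 1" "2 * j < i" using that j by auto
      have "xs ! i \<in> set xs" using i by (auto simp: p_def)
      moreover have "xs ! i \<noteq> xs ! 0" "xs ! i \<noteq> xs ! (p - 1)"
        using i ne nth_eq_iff_index_eq[OF dx(1), of i 0] nth_eq_iff_index_eq[OF dx(1), of i "p - 1"]
        by (auto simp: p_def)
      moreover have "xs ! i \<notin> (!) xs ` {1..2*j}" using i dx(1) by (auto simp: nth_eq_iff_index_eq p_def)
      ultimately show ?thesis using Ls(4) dx(2) by (auto simp: Y_def U_def)
    qed
    have "\<exists>Ms. path_system F Y Ms \<and> Suc (length Ms) = length Ls \<and>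
      length (concat Ms) = Suc (length (concat Ls)) \<and>
      set (concat Ms) \<subseteq> insert y (insert z (set (concat Ls))) \<and> (\<forall>L\<in>set Ms. hd L \<in> U \<and> last L \<in> U)"
    proof (rule path_system_merge[OF assms(3) Ls(1)])
      show "3 \<le> length Ls" using Ls(2) Suc.prems by linarith
      show "y \<in> Y" "z \<in> Y" "y \<notin> set (concat Ls)" "z \<notin> set (concat Ls)" using new by (auto simp: y_def z_def)
      show "F u y \<or> F u z" if "u \<in> U" for u
        using pair[OF that, of "2*j+1"] j by (simp add: y_def z_def)
    qed (use Ls in auto)
    then obtain Ms where Ms: "path_system F Y Ms" "Suc (length Ms) = length Ls"
      "length (concat Ms) = Suc (length (concat Ls))"
      "set (concat Ms) \<subseteq> insert y (insert z (set (concat Ls)))" "\<forall>L\<in>set Ms. hd L \<in> U \<and> last L \<in> U" by blast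
    have "insert y (insert z (set (concat Ls))) \<subseteq> U \<union> (!) xs ` {1..2 * Suc j}"
      using Ls(4) by (auto simp: y_def z_def)
    then have "set (concat Ms) \<subseteq> U \<union> (!) xs ` {1..2 * Suc j}" using Ms(4) by (rule order_trans[rotated])
    moreover have "length Ms + Suc j = r + 1" "length (concat Ms) = r + 1 + Suc j"
      using Ms(2,3) Ls(2,3) by linarith+
    ultimately show ?case using Ms(1,5) by blast
  qed
  \<comment> \<open>Two \<open>F\<close>-paths with \<open>2 * r\<close> vertices in total remain;
    the ends of \<open>xs\<close> raise this to \<open>2 * r + 2\<close>, which exceeds
    \<open>p\<close>.\<close>
  from this[of "r - 1"] r obtain Ls where Ls: "path_system F Y Ls" "length Ls = 2" "length (concat Ls) = 2 * r"
    "\<And>L. L \<in> set Ls \<Longrightarrow> hd L \<in> U \<and> last L \<in> U" by auto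
  from Ls(2) obtain s t where st: "Ls = [s, t]" by (auto simp: length_Suc_conv numeral_2_eq_2)
  have hl: "hd xs = xs ! 0" "last xs = xs ! (p - 1)" using ne by (auto simp: p_def hd_conv_nth last_conv_nth)
  have xn: "xs ! 0 \<noteq> xs ! (p - 1)"
    using nth_eq_iff_index_eq[OF dx(1), of 0 "p - 1"] len ne by (simp add: p_def)
  have xX: "hd xs \<in> X" "last xs \<in> X" using ne dx(2) by auto
  have "F (last s) (hd xs)" "F (hd t) (hd xs)" "F (last t) (last xs)" using Ls(4) ends st by auto
  moreover have "F (hd xs) (hd t)" using calculation(2) assms(3) by (metis sympD)
  ultimately have "path_in F X (s @ hd xs # t @ [last xs])"
    using Ls(1) xX xn unfolding st
    by (auto simp: path_system_def path_in_def successively_append_iff successively_Cons Y_def hl)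
  moreover have "length xs + 1 \<le> length (s @ hd xs # t @ [last xs])" using Ls(3) r st by (simp add: p_def)
  ultimately show ?thesis by (rule has_pathI)
qed

text \<open>Due to Gerencser and Gyarfas.\<close>

theorem path_path_ramsey:
  assumes "finite X" "symp E" "symp F" "\<And>u v. u \<in> X \<Longrightarrow> v \<in> X \<Longrightarrow> u \<noteq> v \<Longrightarrow> E u v \<or> F u v"
    and n: "n + (n - 1) div 2 \<le> card X"
  shows "has_path E X n \<or> has_path F X n"
proof (rule ccontr)
  assume no: "\<not> ?thesis"
  obtain xs where xs: "path_in E X xs" "\<And>ys. path_in E X ys \<Longrightarrow> length ys \<le> length xs"
    using longest_path[OF assms(1)] by metis
  obtain zs where zs: "path_in F X zs" "\<And>ys. path_in F X ys \<Longrightarrow> length ys \<le> length zs"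
    using longest_path[OF assms(1)] by metis
  have small: "length xs < n" "length zs < n" using no xs(1) zs(1) has_pathI by (meson not_le)+
  then have "X \<noteq> {}" using n by auto
  then obtain u where u: "u \<in> X" by blast
  then have "path_in E X [u]" by (simp add: path_in_def)
  then have "2 \<le> n" using xs(2) small by fastforce
  then have "2 \<le> card X" using n by linarith
  then obtain v where v: "v \<in> X" "u \<noteq> v" using u
    by (metis One_nat_def Suc_1 card_1_singleton_iff card.empty is_singletonI' is_singleton_def not_less_eq_eq
        numeral_2_eq_2 order_refl singletonD le_SucI zero_le)
  have "path_in E X [u, v] \<or> path_in F X [u, v]" using u v assms(4) by (auto simp: path_in_def)
  then have two: "2 \<le> length xs \<or> 2 \<le> length zs" using xs(2) zs(2) by fastforce
  \<comment> \<open>The longer of the two paths has at least two vertices and fewer than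
    \<open>n\<close>, so the other colour has a path longer by one vertex, against
    maximality.\<close>
  show False
  proof (cases "length zs \<le> length xs")
    case True
    have "length xs + length xs div 2 + 1 \<le> card X" using small n by linarith
    then have "has_path F X (length xs + 1)"
      using long_path_other_colour[OF assms(1-4) xs] two True by linarith
    then show False using zs(2) True by (fastforce simp: has_path_def)
  next
    case False
    have "length zs + length zs div 2 + 1 \<le> card X" using small n by linarith
    then have "has_path E X (length zs + 1)"
      using long_path_other_colour[OF assms(1,3,2) _ zs] assms(4) two False by (metis le_trans nat_le_linear)
    then show False using xs(2) False by (fastforce simp: has_path_def)
  qed
qed

text \<open>If some vertex has few \<open>E\<close>-neighbours, its \<open>F\<close>-neighbourhood is large enough for
  the path Ramsey number. Otherwise there are at least three \<open>E\<close>-components, with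
  between \<open>n div 2 + 1\<close> and \<open>n - 1\<close> vertices each; the centre and the path come from different ones.\<close>

theorem path_kipas_ramsey:
  assumes "finite X" "symp E" "symp F" "irreflp E"
    and EF: "\<And>u v. u \<in> X \<Longrightarrow> v \<in> X \<Longrightarrow> u \<noteq> v \<Longrightarrow> E u v \<or> F u v"
    and n: "2 \<le> n" "2 * n \<le> card X" and no: "\<not> has_path E X n"
  shows "has_kipas F X n"
proof (cases "\<exists>v\<in>X. card (nbrs E X v) < n div 2")
  case True
  then obtain v where v: "v \<in> X" "card (nbrs E X v) < n div 2" by blast
  have "X \<subseteq> insert v (nbrs E X v \<union> nbrs F X v)" using EF v(1) by (auto simp: nbrs_def)
  then have "card X \<le> card (insert v (nbrs E X v \<union> nbrs F X v))"
    using assms(1) by (intro card_mono) auto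
  also have "\<dots> \<le> Suc (card (nbrs E X v \<union> nbrs F X v))" by (rule card_insert_le_m1) auto
  also have "card (nbrs E X v \<union> nbrs F X v) \<le> card (nbrs E X v) + card (nbrs F X v)" by (rule card_Un_le)
  finally have "n + (n - 1) div 2 \<le> card (nbrs F X v)" using v(2) n by linarith
  then have "has_path E (nbrs F X v) n \<or> has_path F (nbrs F X v) n"
    using assms by (intro path_path_ramsey) (auto simp: nbrs_def)
  then have "has_path F (nbrs F X v) n" using no has_path_mono nbrs_subset by (metis order_refl)
  then show ?thesis using v(1) by (auto simp: has_kipas_def)
next
  case False
  define h where "h = n div 2"
  have deg: "h \<le> card (nbrs E X v)" if "v \<in> X" for v using False that by (auto simp: h_def)
  have "X \<noteq> {}" using n by auto
  obtain xs where xs: "path_in E X xs" "\<And>ys. path_in E X ys \<Longrightarrow> length ys \<le> length xs"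
    using longest_path[OF assms(1)] by metis
  have sx: "set xs \<subseteq> X" "distinct xs" using xs by (auto simp: path_in_def)
  have lx: "length xs < n" using no has_pathI[OF xs(1)] by (meson not_le)
  then have "length xs \<le> 2 * h" by (simp add: h_def)
  note cx = dirac_closed[OF assms(1,2,4) deg xs this]
  have lx': "h + 1 \<le> length xs" using longest_path_length[OF assms(1,2,4) \<open>X \<noteq> {}\<close> deg xs] .
  define Y where "Y = X - set xs"
  have Y: "finite Y" "Y \<subseteq> X" "card Y = card X - length xs"
    using assms(1) sx by (auto simp: Y_def card_Diff_subset distinct_card)
  then have "card Y > 0" using lx n by linarith
  then have "Y \<noteq> {}" by auto
  have degY: "h \<le> card (nbrs E Y v)" if "v \<in> Y" for v
  proof -
    have "nbrs E Y v = nbrs E X v"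
      using closed_compl_degree[OF assms(2) sx(1)] cx that unfolding Y_def by metis
    then show ?thesis using deg[of v] that by (simp add: Y_def)
  qed
  obtain ys where ys: "path_in E Y ys" "\<And>zs. path_in E Y zs \<Longrightarrow> length zs \<le> length ys"
    using longest_path[OF Y(1)] by metis
  have sy: "set ys \<subseteq> Y" "distinct ys" using ys by (auto simp: path_in_def)
  have ly: "length ys < n" using no has_pathI[OF path_in_mono[OF ys(1) Y(2)]] by (meson not_le)
  then have "length ys \<le> 2 * h" by (simp add: h_def)
  note cy = dirac_closed[OF Y(1) assms(2,4) degY ys this]
  have ly': "h + 1 \<le> length ys" using longest_path_length[OF Y(1) assms(2,4) \<open>Y \<noteq> {}\<close> degY ys] .
  have "card (Y - set ys) = card Y - length ys"
    using Y sy by (simp add: card_Diff_subset distinct_card)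
  \<comment> \<open>Two paths with fewer than \<open>n\<close> vertices each cannot exhaust
    \<open>2 * n\<close> vertices.\<close>
  then have "card (Y - set ys) > 0" using Y(3) lx ly n by linarith
  then obtain v where v: "v \<in> Y" "v \<notin> set ys" by (metis DiffE card_gt_0_iff ex_in_conv)
  have sE: "E x y \<Longrightarrow> E y x" for x y using assms(2) by (rule sympD)
  \<comment> \<open>The set \<open>set xs\<close> is closed under \<open>E\<close>, so
    \<open>F\<close> joins it completely to \<open>set ys\<close>; alternating gives
    \<open>2 * h + 1\<close> vertices.\<close>
  have "has_path F (set xs \<union> set ys) n"
  proof (rule join_path_simple[where d = h])
    show "F x y" if "x \<in> set xs" "y \<in> set ys" for x y
      using cx[of x y] EF[of x y] that sx sy by (auto simp: Y_def)
    show "h \<le> card (set xs)" "h + 1 \<le> card (set ys)" using lx' ly' sx sy by (auto simp: distinct_card)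
  qed (use sx sy assms in \<open>auto simp: Y_def h_def\<close>)
  moreover have "F v u" if "u \<in> set xs \<union> set ys" for u
  proof -
    have "\<not> E u v" using cx[of u v] cy[of u v] that v Y(2) by (auto simp: Y_def)
    then have "\<not> E v u" using sE by blast
    moreover have "u \<in> X" "v \<in> X" "u \<noteq> v" using that v sx sy by (auto simp: Y_def)
    ultimately show ?thesis using EF by blast
  qed
  then have "set xs \<union> set ys \<subseteq> nbrs F X v" using sx sy by (auto simp: nbrs_def Y_def)
  ultimately show ?thesis using v Y(2) unfolding has_kipas_def by (meson has_path_mono order_refl subsetD)
qed

section \<open>Colourings without a rainbow claw\<close>

text \<open>A colouring also assigns a value to singletons, hence the condition
  \<open>u \<noteq> v\<close>, which makes the relation irreflexive.\<close>

definition adj :: "('a set \<Rightarrow> nat) \<Rightarrow> nat \<Rightarrow> 'a \<Rightarrow> 'a \<Rightarrow> bool" where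
  "adj c p u v \<longleftrightarrow> u \<noteq> v \<and> c {u, v} = p"

definition coloured_within :: "('a set \<Rightarrow> nat) \<Rightarrow> nat set \<Rightarrow> 'a set \<Rightarrow> bool" where
  "coloured_within c P A \<longleftrightarrow> (\<forall>u\<in>A. \<forall>v\<in>A. u \<noteq> v \<longrightarrow> c {u, v} \<in> P)"

definition joined :: "('a set \<Rightarrow> nat) \<Rightarrow> nat \<Rightarrow> 'a set \<Rightarrow> 'a set \<Rightarrow> bool" where
  "joined c p A B \<longleftrightarrow> A \<inter> B = {} \<and> (\<forall>u\<in>A. \<forall>v\<in>B. c {u, v} = p)"

lemma symp_adj [simp]: "symp (adj c p)"
  by (auto simp: adj_def symp_def insert_commute)

lemma irreflp_adj [simp]: "irreflp (adj c p)"
  by (auto simp: adj_def irreflp_def)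

lemma joined_sym: "joined c p A B \<Longrightarrow> joined c p B A"
  unfolding joined_def by (metis Int_commute insert_commute)

lemma coloured_within_sym: "coloured_within c {p, q} A \<Longrightarrow> coloured_within c {q, p} A"
  by (simp add: insert_commute)

lemma has_kipas_mono: "has_kipas E X n \<Longrightarrow> X \<subseteq> Y \<Longrightarrow> has_kipas E Y n"
  unfolding has_kipas_def nbrs_def by (smt (verit) Collect_mono has_path_mono order_refl subset_iff)

section \<open>Degrees and kipases in joined parts\<close>

lemma degree_sum:
  assumes "finite A" "v \<in> A" "coloured_within c {p, q} A"
  shows "card A \<le> 1 + card (nbrs (adj c p) A v) + card (nbrs (adj c q) A v)"
proof -
  let ?P = "nbrs (adj c p) A v" and ?Q = "nbrs (adj c q) A v"
  have "A \<subseteq> insert v (?P \<union> ?Q)" using assms by (auto simp: nbrs_def adj_def coloured_within_def)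
  then have "card A \<le> card (insert v (?P \<union> ?Q))" using assms(1) by (intro card_mono) auto
  also have "\<dots> \<le> Suc (card (?P \<union> ?Q))" by (rule card_insert_le_m1) auto
  also have "card (?P \<union> ?Q) \<le> card ?P + card ?Q" by (rule card_Un_le)
  finally show ?thesis by simp
qed

text \<open>The centre is \<open>v\<close>. At most two \<open>p\<close>-paths of \<open>B\<close>
  with \<open>2 * t\<close> edges are spread out and interleaved with \<open>d\<close> neighbours of
  \<open>v\<close>; \<open>1 \<le> d\<close> leaves room for both paths.\<close>

lemma join_kipas:
  assumes "finite A" "finite B" "joined c p A B" "v \<in> A"
    and "d \<le> card (nbrs (adj c p) A v)" "\<And>u. u \<in> B \<Longrightarrow> t \<le> card (nbrs (adj c p) B u)"
    and "1 \<le> d" "d + 1 \<le> card B" "n \<le> d + card B" "n \<le> 2 * d + 1 + 2 * t"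
  shows "has_kipas (adj c p) (A \<union> B) n"
proof -
  have "B \<noteq> {}" using assms by auto
  obtain Ls where Ls: "path_system (adj c p) B Ls" "length Ls \<le> 2"
    "min (card B) (length Ls + 2 * t) \<le> length (concat Ls)"
    using dirac_path_system[OF assms(2) \<open>B \<noteq> {}\<close> symp_adj irreflp_adj assms(6)] by blast
  let ?N = "nbrs (adj c p) A v"
  have "has_path (adj c p) (?N \<union> B) n"
  proof (rule join_path[where d = d and e = "2 * t", OF _ assms(2) symp_adj _ _ Ls(1)])
    show "?N \<inter> B = {}" using assms(3) by (auto simp: nbrs_def joined_def)
    show "adj c p x b" if "x \<in> ?N" "b \<in> B" for x b
      using that assms(3) by (auto simp: nbrs_def joined_def adj_def)
  qed (use assms Ls in \<open>auto simp: add.commute\<close>)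
  moreover have "?N \<union> B \<subseteq> nbrs (adj c p) (A \<union> B) v"
    using assms(3,4) by (auto simp: nbrs_def joined_def adj_def)
  ultimately show ?thesis using assms(4) unfolding has_kipas_def by (meson UnI1 has_path_mono order_refl)
qed

text \<open>Alternation alone, with \<open>t = 0\<close>, would give a path with
  \<open>2 * (n div 2) + 1 \<ge> n\<close> vertices around \<open>v\<close>.\<close>

lemma joined_degree:
  assumes "finite A" "finite B" "joined c p A B" "v \<in> A" "n div 2 + 1 \<le> card B" "2 \<le> n"
    and "\<not> has_kipas (adj c p) (A \<union> B) n"
  shows "card (nbrs (adj c p) A v) < n div 2"
proof (rule ccontr)
  assume "\<not> ?thesis"
  then have "has_kipas (adj c p) (A \<union> B) n"
    using assms by (intro join_kipas[OF assms(1-4), where d = "n div 2" and t = 0]) auto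
  then show False using assms(7) by blast
qed

text \<open>Colour \<open>q\<close> has minimum degree at least \<open>card A - n div 2\<close>, so
  Dirac's argument gives a Hamiltonian path.\<close>

lemma sparse_complement_path:
  assumes "finite A" "coloured_within c {p, q} A" "\<And>v. v \<in> A \<Longrightarrow> card (nbrs (adj c p) A v) < n div 2"
    and "n \<le> card A"
  shows "has_path (adj c q) A n"
proof -
  have "has_path (adj c q) A (card A)"
  proof (rule dirac_hamiltonian_path[where d = "card A - n div 2"])
    show "card A - n div 2 \<le> card (nbrs (adj c q) A v)" if "v \<in> A" for v
      using degree_sum[OF assms(1) that assms(2)] assms(3)[OF that] by linarith
    show "card A \<le> 2 * (card A - n div 2) + 1" using assms(4) by linarith
  qed (use assms in auto)
  then show ?thesis using assms(4) has_path_mono by blast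
qed

text \<open>Any vertex of \<open>B\<close> would be a centre for such a path.\<close>

lemma joined_no_path:
  assumes "joined c p A B" "B \<noteq> {}" "\<not> has_kipas (adj c p) (A \<union> B) n"
  shows "\<not> has_path (adj c p) A n"
proof
  assume P: "has_path (adj c p) A n"
  obtain v where v: "v \<in> B" using assms by auto
  have "A \<subseteq> nbrs (adj c p) (A \<union> B) v"
    using v assms(1) joined_sym[OF assms(1)] by (auto simp: nbrs_def joined_def adj_def)
  then have "has_path (adj c p) (nbrs (adj c p) (A \<union> B) v) n" using P has_path_mono by blast
  then show False using assms(3) v by (auto simp: has_kipas_def)
qed

text \<open>The \<open>q\<close>-neighbourhood of \<open>v\<close> inherits the small
  \<open>p\<close>-degrees, so with \<open>n\<close> vertices it would contain a
  \<open>q\<close>-path, with centre \<open>v\<close>.\<close>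

lemma degree_less_n:
  assumes "finite A" "coloured_within c {p, q} A" "\<And>v. v \<in> A \<Longrightarrow> card (nbrs (adj c p) A v) < n div 2"
    and "v \<in> A" "\<not> has_kipas (adj c q) A n"
  shows "card (nbrs (adj c q) A v) < n"
proof (rule ccontr)
  let ?N = "nbrs (adj c q) A v"
  assume "\<not> card ?N < n"
  then have "n \<le> card ?N" by simp
  have "has_path (adj c q) ?N n"
  proof (rule sparse_complement_path[OF _ _ _ \<open>n \<le> card ?N\<close>])
    show "coloured_within c {p, q} ?N" using assms(2) by (auto simp: nbrs_def coloured_within_def)
    show "card (nbrs (adj c p) ?N u) < n div 2" if "u \<in> ?N" for u
    proof -
      have "nbrs (adj c p) ?N u \<subseteq> nbrs (adj c p) A u" by (auto simp: nbrs_def)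
      then have "card (nbrs (adj c p) ?N u) \<le> card (nbrs (adj c p) A u)" using assms(1) by (simp add: card_mono)
      also have "\<dots> < n div 2" using that assms(3) by (auto simp: nbrs_def)
      finally show ?thesis .
    qed
  qed (use assms(1) in simp)
  then show False using assms(4,5) by (auto simp: has_kipas_def)
qed

text \<open>The path-kipas Ramsey bound gives an \<open>r\<close>-kipas or a \<open>p\<close>-path
  in \<open>B\<close>, and any vertex of \<open>A\<close> is a centre for the latter.\<close>

lemma two_parts_small:
  assumes "finite B" "joined c p A B" "A \<noteq> {}" "coloured_within c {p, r} B"
    and "2 \<le> n" "2 * n \<le> card B"
  shows "has_kipas (adj c p) (A \<union> B) n \<or> has_kipas (adj c r) B n"
proof (rule disjCI)
  assume no: "\<not> has_kipas (adj c r) B n"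
  have "has_path (adj c p) B n"
  proof (rule ccontr)
    assume "\<not> ?thesis"
    then have "has_kipas (adj c r) B n"
      using assms by (intro path_kipas_ramsey[of B "adj c p"]) (auto simp: coloured_within_def adj_def)
    then show False using no by blast
  qed
  then show "has_kipas (adj c p) (A \<union> B) n"
    using joined_no_path[OF joined_sym[OF assms(2)] assms(3)] by (auto simp: Un_commute)
qed

lemma two_parts:
  assumes fin: "finite A" "finite B" and ne: "A \<noteq> {}" "B \<noteq> {}" and J: "joined c p A B"
    and A: "coloured_within c {p, q} A" and B: "coloured_within c {p, r} B"
    and n: "2 \<le> n" "2 * n + n div 2 \<le> card A + card B"
  shows "\<exists>s. has_kipas (adj c s) (A \<union> B) n"
proof (rule ccontr)
  assume no: "\<not> ?thesis"
  then have noA: "\<not> has_kipas (adj c s) A n" and noB: "\<not> has_kipas (adj c s) B n" for s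
    using has_kipas_mono by blast+
  define h where "h = n div 2"
  consider "card A \<le> h" | "card B \<le> h" | "h + 1 \<le> card A" "h + 1 \<le> card B" by linarith
  then show False
  proof cases
    case 1
    then have "2 * n \<le> card B" using n by (simp add: h_def)
    then show False using two_parts_small[OF fin(2) J ne(1) B n(1)] no noB by blast
  next
    case 2
    then have "2 * n \<le> card A" using n by (simp add: h_def)
    then show False using two_parts_small[OF fin(1) joined_sym[OF J] ne(2) A n(1)] no noA
      by (auto simp: Un_commute)
  next
    case 3
    have pA: "card (nbrs (adj c p) A v) < h" if "v \<in> A" for v
      using joined_degree[OF fin J that _ n(1)] 3 no by (auto simp: h_def)
    have pB: "card (nbrs (adj c p) B v) < h" if "v \<in> B" for v
      using joined_degree[OF fin(2,1) joined_sym[OF J] that _ n(1)] 3 no by (auto simp: h_def Un_commute)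
    \<comment> \<open>Fewer than \<open>n\<close> neighbours have the other colour, and the rest
      have colour \<open>p\<close>.\<close>
    have qA: "card A - n \<le> card (nbrs (adj c p) A v)" if "v \<in> A" for v
      using degree_less_n[OF fin(1) A pA[unfolded h_def] that noA] degree_sum[OF fin(1) that A] by linarith
    have rB: "card B - n \<le> card (nbrs (adj c p) B v)" if "v \<in> B" for v
      using degree_less_n[OF fin(2) B pB[unfolded h_def] that noB] degree_sum[OF fin(2) that B] by linarith
    obtain v w where v: "v \<in> A" "w \<in> B" using ne by auto
    have lt: "card A - n < h" "card B - n < h" using pA[OF v(1)] qA[OF v(1)] pB[OF v(2)] rB[OF v(2)] by auto
    have "has_kipas (adj c p) (A \<union> B) n"
    proof (rule join_kipas[OF fin J v(1) qA[OF v(1)] rB])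
      show "1 \<le> card A - n" "card A - n + 1 \<le> card B" "n \<le> card A - n + card B"
        using lt n 3 by (auto simp: h_def)
      \<comment> \<open>By the size hypothesis the right side is at least
        \<open>2 * h + 1\<close>.\<close>
      show "n \<le> 2 * (card A - n) + 1 + 2 * (card B - n)" using n lt unfolding h_def by linarith
    qed
    then show False using no by blast
  qed
qed

text \<open>With \<open>n\<close> vertices and small \<open>p\<close>-degrees, \<open>A\<close>
  would have a \<open>q\<close>-path for which any vertex of \<open>C\<close> is a centre.\<close>

lemma three_parts_less:
  assumes fin: "finite A" "finite B" and J: "joined c p A B" "joined c q A C" and "C \<noteq> {}"
    and A: "coloured_within c {p, q} A" and n: "2 \<le> n" "n div 2 + 1 \<le> card B"
    and no: "\<not> has_kipas (adj c p) (A \<union> B) n" "\<not> has_kipas (adj c q) (A \<union> C) n"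
  shows "card A < n"
proof (rule ccontr)
  assume "\<not> ?thesis"
  then have "has_path (adj c q) A n"
    using joined_degree[OF fin J(1) _ n(2,1) no(1)] by (intro sparse_complement_path[OF fin(1) A]) auto
  then show False using joined_no_path[OF J(2) assms(5) no(2)] by blast
qed

section \<open>Balancing the degrees of three parts\<close>

lemma max_degree:
  assumes "finite A" "A \<noteq> {}"
  obtains v where "v \<in> A" "\<And>u. u \<in> A \<Longrightarrow> card (nbrs E A u) \<le> card (nbrs E A v)"
proof -
  let ?D = "(\<lambda>v. card (nbrs E A v)) ` A"
  have "Max ?D \<in> ?D" using assms by (intro Max_in) auto
  then obtain v where "v \<in> A" "Max ?D = card (nbrs E A v)" by auto
  then show thesis using that[of v] assms Max_ge[of ?D] by (metis (no_types, lifting) finite_imageI imageI)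
qed

text \<open>The \<open>p\<close>-degrees in \<open>B\<close> are at least
  \<open>card B - 1 - y\<close>, which serves as minimum degree for a joined kipas with centre
  \<open>v\<close>. The bound on the \<open>q\<close>-degrees in \<open>A\<close> makes the
  \<open>p\<close>-degree of \<open>v\<close> large enough for the side conditions.\<close>

lemma degree_tradeoff:
  assumes fin: "finite A" "finite B" and J: "joined c p A B"
    and A: "coloured_within c {p, q} A" and B: "coloured_within c {p, r} B"
    and n: "2 \<le> n" "n div 2 + 1 \<le> card B" "n div 2 + 1 \<le> card A" "n + n div 2 \<le> card A + card B"
    and degA: "\<And>u. u \<in> A \<Longrightarrow> card (nbrs (adj c q) A u) < n div 2"
    and v: "v \<in> A"
    and y: "\<And>u. u \<in> B \<Longrightarrow> card (nbrs (adj c r) B u) \<le> y" "y < n div 2"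
    and no: "\<not> has_kipas (adj c p) (A \<union> B) n"
  shows "2 * card (nbrs (adj c p) A v) + 2 * card B \<le> n + 2 * y"
proof (rule ccontr)
  assume neg: "\<not> ?thesis"
  let ?d = "card (nbrs (adj c p) A v)"
  have d: "?d < n div 2" using joined_degree[OF fin J v n(2,1) no] .
  have d2: "card A \<le> n div 2 + ?d" using degree_sum[OF fin(1) v A] degA[OF v] by linarith
  have "has_kipas (adj c p) (A \<union> B) n"
  proof (rule join_kipas[OF fin J v order_refl])
    show "card B - 1 - y \<le> card (nbrs (adj c p) B u)" if "u \<in> B" for u
      using degree_sum[OF fin(2) that B] y(1)[OF that] by linarith
  qed (use d d2 n y(2) neg in linarith)+
  then show False using no by blast
qed

lemma three_parts:
  assumes fin: "finite A" "finite B" "finite C" and ne: "A \<noteq> {}" "B \<noteq> {}" "C \<noteq> {}"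
    and J: "joined c p A B" "joined c q A C" "joined c r B C"
    and A: "coloured_within c {p, q} A" and B: "coloured_within c {p, r} B" and C: "coloured_within c {q, r} C"
    and n: "2 \<le> n" "2 * n + n div 2 \<le> card A + card B + card C"
  shows "\<exists>s. has_kipas (adj c s) (A \<union> B \<union> C) n"
proof (rule ccontr)
  assume no: "\<not> ?thesis"
  then have noX: "\<not> has_kipas (adj c s) X n" if "X \<subseteq> A \<union> B \<union> C" for s X
    using has_kipas_mono that by blast
  have no2: "\<not> has_kipas (adj c s) (A \<union> B) n" "\<not> has_kipas (adj c s) (B \<union> A) n"
    "\<not> has_kipas (adj c s) (A \<union> C) n" "\<not> has_kipas (adj c s) (C \<union> A) n"
    "\<not> has_kipas (adj c s) (B \<union> C) n" "\<not> has_kipas (adj c s) (C \<union> B) n" for s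
    by (auto intro!: noX)
  note J' = J[THEN joined_sym]
  note A' = coloured_within_sym[OF A] and B' = coloured_within_sym[OF B] and C' = coloured_within_sym[OF C]
  define h where "h = n div 2"
  \<comment> \<open>A part with \<open>n + h\<close> vertices would have a path on \<open>n\<close>
    vertices in one of its colours, and some vertex of another part would be its centre.\<close>
  have gg: "card X < n + h"
    if "finite X" "coloured_within c {s, t} X" "\<not> has_path (adj c s) X n" "\<not> has_path (adj c t) X n" for X s t
  proof (rule ccontr)
    assume "\<not> ?thesis"
    then have "n + (n - 1) div 2 \<le> card X" unfolding h_def by linarith
    then have "has_path (adj c s) X n \<or> has_path (adj c t) X n"
      using that(1,2) by (intro path_path_ramsey) (auto simp: coloured_within_def adj_def)
    then show False using that by blast
  qed
  have lt: "card A < n + h" "card B < n + h" "card C < n + h"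
    using gg[OF fin(1) A] gg[OF fin(2) B] gg[OF fin(3) C]
      joined_no_path[OF J(1) ne(2) no2(1)] joined_no_path[OF J(2) ne(3) no2(3)]
      joined_no_path[OF J'(1) ne(1) no2(2)] joined_no_path[OF J(3) ne(3) no2(5)]
      joined_no_path[OF J'(2) ne(1) no2(4)] joined_no_path[OF J'(3) ne(2) no2(6)] by blast+
  have hn: "2 * h \<le> n" "n \<le> 2 * h + 1" "1 \<le> h" using n(1) by (auto simp: h_def)
  have "card A < n" if "h + 1 \<le> card B \<or> h + 1 \<le> card C"
    using that three_parts_less[OF fin(1,2) J(1,2) ne(3) A n(1) _ no2(1,3)]
      three_parts_less[OF fin(1,3) J(2,1) ne(2) A' n(1) _ no2(3,1)] by (auto simp: h_def)
  moreover have "card B < n" if "h + 1 \<le> card A \<or> h + 1 \<le> card C"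
    using that three_parts_less[OF fin(2,1) J'(1) J(3) ne(3) B n(1) _ no2(2,5)]
      three_parts_less[OF fin(2,3) J(3) J'(1) ne(1) B' n(1) _ no2(5,2)] by (auto simp: h_def)
  moreover have "card C < n" if "h + 1 \<le> card A \<or> h + 1 \<le> card B"
    using that three_parts_less[OF fin(3,1) J'(2,3) ne(2) C n(1) _ no2(4,6)]
      three_parts_less[OF fin(3,2) J'(3,2) ne(1) C' n(1) _ no2(6,4)] by (auto simp: h_def)
  \<comment> \<open>If two parts had at most \<open>h\<close> vertices each, the third would have at
    least \<open>2 * n - h \<ge> n + h\<close>, which is excluded; so all three implications
    apply.\<close>
  ultimately have "card A < n" "card B < n" "card C < n" using lt hn n(2) unfolding h_def[symmetric] by linarith+
  then have big: "h + 1 \<le> card A" "h + 1 \<le> card B" "h + 1 \<le> card C" using n(2) unfolding h_def by linarith+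
  note big' = big[unfolded h_def]
  have deg: "\<And>v. v \<in> A \<Longrightarrow> card (nbrs (adj c p) A v) < n div 2"
    "\<And>v. v \<in> A \<Longrightarrow> card (nbrs (adj c q) A v) < n div 2"
    "\<And>v. v \<in> B \<Longrightarrow> card (nbrs (adj c p) B v) < n div 2"
    "\<And>v. v \<in> B \<Longrightarrow> card (nbrs (adj c r) B v) < n div 2"
    "\<And>v. v \<in> C \<Longrightarrow> card (nbrs (adj c q) C v) < n div 2"
    "\<And>v. v \<in> C \<Longrightarrow> card (nbrs (adj c r) C v) < n div 2"
    using joined_degree[OF fin(1,2) J(1) _ big'(2) n(1) no2(1)] joined_degree[OF fin(1,3) J(2) _ big'(3) n(1) no2(3)]
      joined_degree[OF fin(2,1) J'(1) _ big'(1) n(1) no2(2)] joined_degree[OF fin(2,3) J(3) _ big'(3) n(1) no2(5)]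
      joined_degree[OF fin(3,1) J'(2) _ big'(1) n(1) no2(4)] joined_degree[OF fin(3,2) J'(3) _ big'(2) n(1) no2(6)]
    by blast+
  have lt2: "card X < 2 * h" if "finite X" "X \<noteq> {}" "coloured_within c {s, t} X"
    "\<And>v. v \<in> X \<Longrightarrow> card (nbrs (adj c s) X v) < n div 2" "\<And>v. v \<in> X \<Longrightarrow> card (nbrs (adj c t) X v) < n div 2" for X s t
  proof -
    obtain v where v: "v \<in> X" using \<open>X \<noteq> {}\<close> by auto
    show ?thesis using degree_sum[OF that(1) v that(3)] that(4)[OF v] that(5)[OF v] unfolding h_def by linarith
  qed
  have "card A < 2 * h" "card B < 2 * h" "card C < 2 * h"
    using lt2[OF fin(1) ne(1) A deg(1,2)] lt2[OF fin(2) ne(2) B deg(3,4)] lt2[OF fin(3) ne(3) C deg(5,6)] by auto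
  \<comment> \<open>Leaving out one part loses fewer than \<open>2 * h \<le> n\<close> of at least
    \<open>2 * n + h\<close> vertices.\<close>
  then have pairs: "n + n div 2 \<le> card A + card B" "n + n div 2 \<le> card A + card C" "n + n div 2 \<le> card B + card C"
    using n(2) hn unfolding h_def by linarith+
  then have pairs': "n + n div 2 \<le> card B + card A" "n + n div 2 \<le> card C + card A" "n + n div 2 \<le> card C + card B"
    by linarith+
  \<comment> \<open>The tradeoff compares these six maximum degrees with each other so that each
    occurs once on either side and cancels in the sum.\<close>
  obtain ap where ap: "ap \<in> A" "\<And>u. u \<in> A \<Longrightarrow> card (nbrs (adj c p) A u) \<le> card (nbrs (adj c p) A ap)"
    using max_degree[OF fin(1) ne(1)] by metis
  obtain aq where aq: "aq \<in> A" "\<And>u. u \<in> A \<Longrightarrow> card (nbrs (adj c q) A u) \<le> card (nbrs (adj c q) A aq)"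
    using max_degree[OF fin(1) ne(1)] by metis
  obtain bp where bp: "bp \<in> B" "\<And>u. u \<in> B \<Longrightarrow> card (nbrs (adj c p) B u) \<le> card (nbrs (adj c p) B bp)"
    using max_degree[OF fin(2) ne(2)] by metis
  obtain br where br: "br \<in> B" "\<And>u. u \<in> B \<Longrightarrow> card (nbrs (adj c r) B u) \<le> card (nbrs (adj c r) B br)"
    using max_degree[OF fin(2) ne(2)] by metis
  obtain cq where cq: "cq \<in> C" "\<And>u. u \<in> C \<Longrightarrow> card (nbrs (adj c q) C u) \<le> card (nbrs (adj c q) C cq)"
    using max_degree[OF fin(3) ne(3)] by metis
  obtain cr where cr: "cr \<in> C" "\<And>u. u \<in> C \<Longrightarrow> card (nbrs (adj c r) C u) \<le> card (nbrs (adj c r) C cr)"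
    using max_degree[OF fin(3) ne(3)] by metis
  \<comment> \<open>For the maximum degrees, the six inequalities add up to \<open>4 * (card A + card B + card C) \<le> 6 * n\<close>.\<close>
  show False
    using degree_tradeoff[OF fin(1,2) J(1) A B n(1) big'(2,1) pairs(1) deg(2) ap(1) br(2) deg(4)[OF br(1)] no2(1)]
      degree_tradeoff[OF fin(2,1) J'(1) B A n(1) big'(1,2) pairs'(1) deg(4) bp(1) aq(2) deg(2)[OF aq(1)] no2(2)]
      degree_tradeoff[OF fin(1,3) J(2) A' C n(1) big'(3,1) pairs(2) deg(1) aq(1) cr(2) deg(6)[OF cr(1)] no2(3)]
      degree_tradeoff[OF fin(3,1) J'(2) C A' n(1) big'(1,3) pairs'(2) deg(6) cq(1) ap(2) deg(1)[OF ap(1)] no2(4)]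
      degree_tradeoff[OF fin(2,3) J(3) B' C' n(1) big'(3,2) pairs(3) deg(3) br(1) cq(2) deg(5)[OF cq(1)] no2(5)]
      degree_tradeoff[OF fin(3,2) J'(3) C' B' n(1) big'(2,3) pairs'(3) deg(5) cr(1) bp(2) deg(3)[OF bp(1)] no2(6)]
      n(2) hn unfolding h_def by linarith
qed

section \<open>The upper bound\<close>

lemma doubleton_edge [simp]:
  "{u, v} \<in> edges (complete_graph m) \<longleftrightarrow> u < m \<and> v < m \<and> u \<noteq> v"
  by (auto simp: complete_graph_def nsets_def card_2_iff doubleton_eq_iff)

lemma edge_complete_graphE:
  assumes "e \<in> edges (complete_graph m)"
  obtains u v where "e = {u, v}" "u < m" "v < m" "u \<noteq> v"
  using assms by (auto simp: complete_graph_def nsets_def card_2_iff)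

text \<open>Translates between embeddings of the kipas and a centre with a list of vertices, the
  form used in the estimates.\<close>

lemma mono_kipas_iff:
  assumes "0 < n"
  shows "has_monochromatic_copy (kipas n) (complete_graph m) c \<longleftrightarrow> (\<exists>s. has_kipas (adj c s) {..<m} n)"
proof
  assume "has_monochromatic_copy (kipas n) (complete_graph m) c"
  then obtain f s where f: "is_copy (kipas n) (complete_graph m) f" "\<And>e. e \<in> edges (kipas n) \<Longrightarrow> c (f ` e) = s"
    by (auto simp: has_monochromatic_copy_def)
  have inj: "inj_on f {0..n}" and im: "\<And>i. i \<le> n \<Longrightarrow> f i < m"
  proof -
    have "verts (kipas n) = {0..n}" by (auto simp: kipas_def path_graph_def)
    then show "inj_on f {0..n}" "\<And>i. i \<le> n \<Longrightarrow> f i < m"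
      using f(1) by (auto simp: is_copy_def complete_graph_def image_subset_iff)
  qed
  have "{0, v} \<in> edges (kipas n)" if "1 \<le> v" "v \<le> n" for v
    using that by (auto simp: kipas_def path_graph_def)
  then have spoke: "c {f 0, f v} = s" if "1 \<le> v" "v \<le> n" for v using f(2)[of "{0, v}"] that by simp
  have "{i, i + 1} \<in> edges (kipas n)" if "1 \<le> i" "i < n" for i
    using that by (auto simp: kipas_def path_graph_def)
  then have rim: "c {f i, f (Suc i)} = s" if "1 \<le> i" "i < n" for i using f(2)[of "{i, i + 1}"] that by simp
  have ne: "f i \<noteq> f j" if "i \<le> n" "j \<le> n" "i \<noteq> j" for i j using inj_onD[OF inj, of i j] that by auto
  let ?xs = "map f [1..<n + 1]"
  have "path_in (adj c s) (nbrs (adj c s) {..<m} (f 0)) ?xs"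
    unfolding path_in_def
  proof (intro conjI)
    show "distinct ?xs" using inj_on_subset[OF inj] by (simp add: distinct_map subset_iff)
    show "set ?xs \<subseteq> nbrs (adj c s) {..<m} (f 0)" using im spoke ne by (auto simp: nbrs_def adj_def)
    show "successively (adj c s) ?xs"
      using rim ne by (auto simp: successively_conv_nth adj_def simp del: upt_Suc)
  qed
  then have "has_path (adj c s) (nbrs (adj c s) {..<m} (f 0)) n" by (auto simp: has_path_def intro!: exI[of _ ?xs])
  then show "\<exists>s. has_kipas (adj c s) {..<m} n" using im[of 0] by (auto simp: has_kipas_def)
next
  assume "\<exists>s. has_kipas (adj c s) {..<m} n"
  then obtain s v xs where v: "v < m" and xs: "distinct xs" "set xs \<subseteq> nbrs (adj c s) {..<m} v"
    "successively (adj c s) xs" "length xs = n"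
    by (auto simp: has_kipas_def has_path_def path_in_def)
  \<comment> \<open>Path vertices of the kipas are numbered from 1, list positions from 0.\<close>
  define f where "f i = (if i = 0 then v else xs ! (i - 1))" for i :: nat
  have spoke: "f i < m" "v \<noteq> f i" "c {v, f i} = s" if "1 \<le> i" "i \<le> n" for i
  proof -
    have "xs ! (i - 1) \<in> set xs" using that xs(4) by auto
    then show "f i < m" "v \<noteq> f i" "c {v, f i} = s" using xs(2) that by (auto simp: f_def nbrs_def adj_def)
  qed
  have rim: "f i \<noteq> f (Suc i)" "c {f i, f (Suc i)} = s" if "1 \<le> i" "i < n" for i
    using that successively_nth[OF xs(3), of "i - 1"] xs(4) by (auto simp: f_def adj_def)
  have "inj_on f {0..n}"
  proof (rule inj_onI)
    fix i j assume ij: "i \<in> {0..n}" "j \<in> {0..n}" "f i = f j"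
    show "i = j"
    proof (cases "i = 0 \<or> j = 0")
      case True
      then show ?thesis using ij spoke(2)[of i] spoke(2)[of j] by (cases "i = 0"; cases "j = 0") (auto simp: f_def)
    next
      case False
      then have "xs ! (i - 1) = xs ! (j - 1)" using ij by (simp add: f_def)
      moreover have "i - 1 < length xs" "j - 1 < length xs" using ij xs(4) False by auto
      ultimately have "i - 1 = j - 1" using nth_eq_iff_index_eq[OF xs(1)] by blast
      then show ?thesis using False by linarith
    qed
  qed
  have e: "f ` e \<in> edges (complete_graph m) \<and> c (f ` e) = s" if "e \<in> edges (kipas n)" for e
  proof -
    from that consider i where "1 \<le> i" "i < n" "e = {i, Suc i}" | i where "1 \<le> i" "i \<le> n" "e = {0, i}"
      by (auto simp: kipas_def path_graph_def)
    then show ?thesis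
    proof cases
      case 1
      then show ?thesis using rim[of i] spoke(1)[of i] spoke(1)[of "Suc i"] by simp
    next
      case 2
      moreover have "f ` {0, i} = {v, f i}" by (simp add: f_def)
      ultimately show ?thesis using spoke[of i] v by simp
    qed
  qed
  have "verts (kipas n) = {0..n}" by (auto simp: kipas_def path_graph_def)
  moreover have "f ` {0..n} \<subseteq> {..<m}"
  proof
    fix y assume "y \<in> f ` {0..n}"
    then obtain i where i: "i \<le> n" "y = f i" by auto
    then show "y \<in> {..<m}" using spoke(1)[of i] v by (cases "i = 0") (auto simp: f_def)
  qed
  ultimately have "is_copy (kipas n) (complete_graph m) f"
    using \<open>inj_on f {0..n}\<close> e by (auto simp: is_copy_def complete_graph_def)
  then show "has_monochromatic_copy (kipas n) (complete_graph m) c"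
    using e unfolding has_monochromatic_copy_def by blast
qed

lemma edges_star_3: "edges (star_graph 3) = {{0, 1}, {0, 2}, {0, 3}}"
proof -
  have "{1..3::nat} = {1, 2, 3}" by auto
  then show ?thesis by (auto simp: star_graph_def)
qed

text \<open>Distinct colours already force the three leaves to be distinct.\<close>

lemma rainbow_starI:
  assumes "v < m" "u1 < m" "u2 < m" "u3 < m" "v \<notin> {u1, u2, u3}"
    and "c {v, u1} \<noteq> c {v, u2}" "c {v, u1} \<noteq> c {v, u3}" "c {v, u2} \<noteq> c {v, u3}"
  shows "has_rainbow_copy (star_graph 3) (complete_graph m) c"
proof -
  define f where "f i = (if i = 0 then v else if i = 1 then u1 else if i = 2 then u2 else u3)" for i :: nat
  have f: "f 0 = v" "f 1 = u1" "f 2 = u2" "f 3 = u3" by (auto simp: f_def)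
  have V: "verts (star_graph 3) = {0, 1, 2, 3}" by (auto simp: star_graph_def)
  have "u1 \<noteq> u2" "u1 \<noteq> u3" "u2 \<noteq> u3" using assms by auto
  then have "inj_on f {0, 1, 2, 3}" using assms(5) f by (auto simp: inj_on_def)
  then have "is_copy (star_graph 3) (complete_graph m) f"
    using assms f unfolding is_copy_def V edges_star_3 by (auto simp: complete_graph_def[of m] nsets_def)
  moreover have "inj_on (\<lambda>e. c (f ` e)) (edges (star_graph 3))"
    using assms f unfolding edges_star_3 by (auto simp: inj_on_def)
  ultimately show ?thesis by (auto simp: has_rainbow_copy_def)
qed

lemma rainbow_starE:
  assumes "has_rainbow_copy (star_graph 3) (complete_graph m) c"
  obtains v u1 u2 u3 where "v < m" "u1 < m" "u2 < m" "u3 < m" "v \<notin> {u1, u2, u3}"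
    "c {v, u1} \<noteq> c {v, u2}" "c {v, u1} \<noteq> c {v, u3}" "c {v, u2} \<noteq> c {v, u3}"
proof -
  obtain f where f: "is_copy (star_graph 3) (complete_graph m) f" "inj_on (\<lambda>e. c (f ` e)) {{0, 1}, {0, 2}, {0, 3}}"
    using assms by (auto simp: has_rainbow_copy_def edges_star_3)
  have "{f 0, f i} \<in> edges (complete_graph m)" if "i \<in> {1, 2, 3}" for i
    using f(1) that by (auto simp: is_copy_def edges_star_3)
  from this[of 1] this[of 2] this[of 3]
  have e: "f 0 < m" "f 1 < m" "f 2 < m" "f 3 < m" "f 0 \<notin> {f 1, f 2, f 3}" by simp_all
  have d: "{0, 1} \<noteq> {0, 2 :: nat}" "{0, 1} \<noteq> {0, 3 :: nat}" "{0, 2} \<noteq> {0, 3 :: nat}"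
    by (auto simp: doubleton_eq_iff)
  have "c (f ` {0, 1}) \<noteq> c (f ` {0, 2})" "c (f ` {0, 1}) \<noteq> c (f ` {0, 3})" "c (f ` {0, 2}) \<noteq> c (f ` {0, 3})"
    using inj_on_eq_iff[OF f(2), of "{0, 1}" "{0, 2}"] inj_on_eq_iff[OF f(2), of "{0, 1}" "{0, 3}"]
      inj_on_eq_iff[OF f(2), of "{0, 2}" "{0, 3}"] d by simp_all
  then show thesis using that[OF e] by simp
qed

text \<open>Here \<open>2 * n + n div 2\<close> is the floor of \<open>5 * n / 2\<close>; the parts
  are read off from the colours that each vertex sees.\<close>

theorem gallai_ramsey_star_kipas_bound:
  assumes n: "2 \<le> n"
  shows "gallai_ramsey_bound 3 (star_graph 3) (kipas n) (2 * n + n div 2)"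
  unfolding gallai_ramsey_bound_def
proof (intro allI impI disjCI)
  fix m :: nat and c :: "nat set \<Rightarrow> nat"
  assume m: "2 * n + n div 2 \<le> m" and ex: "exact_edge_coloring 3 (complete_graph m) c"
    and "\<not> has_monochromatic_copy (kipas n) (complete_graph m) c"
  then have no: "\<not> has_kipas (adj c s) {..<m} n" for s using mono_kipas_iff n by auto
  show "has_rainbow_copy (star_graph 3) (complete_graph m) c"
  proof (rule ccontr)
    assume norain: "\<not> ?thesis"
    obtain p q r where pqr: "c ` edges (complete_graph m) = {p, q, r}" "p \<noteq> q" "p \<noteq> r" "q \<noteq> r"
      using ex by (auto simp: exact_edge_coloring_def card_3_iff)
    define V where "V = {..<m}"
    have col: "c {u, v} \<in> {p, q, r}" if "u \<in> V" "v \<in> V" "u \<noteq> v" for u v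
    proof -
      have "{u, v} \<in> edges (complete_graph m)" using that by (simp add: V_def)
      then show ?thesis using pqr(1) by blast
    qed
    define sees where "sees v s \<longleftrightarrow> (\<exists>u\<in>V. u \<noteq> v \<and> c {v, u} = s)" for v s
    have nosee: "\<not> (sees v p \<and> sees v q \<and> sees v r)" if "v \<in> V" for v
    proof
      assume "sees v p \<and> sees v q \<and> sees v r"
      then obtain u1 u2 u3 where "u1 \<in> V" "u1 \<noteq> v" "c {v, u1} = p" "u2 \<in> V" "u2 \<noteq> v" "c {v, u2} = q"
        "u3 \<in> V" "u3 \<noteq> v" "c {v, u3} = r" unfolding sees_def by blast
      then show False using rainbow_starI[of v m u1 u2 u3 c] norain that pqr by (auto simp: V_def)
    qed
    \<comment> \<open>A vertex may miss several colours; the order of the tests puts it into a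
      single part. Vertices of \<open>C\<close> see \<open>r\<close> and \<open>q\<close>, hence
      miss \<open>p\<close>.\<close>
    define A where "A = {v \<in> V. \<not> sees v r}"
    define B where "B = {v \<in> V. sees v r \<and> \<not> sees v q}"
    define C where "C = {v \<in> V. sees v r \<and> sees v q}"
    have V: "V = A \<union> B \<union> C" and fin: "finite A" "finite B" "finite C"
      by (auto simp: A_def B_def C_def V_def)
    have disj: "A \<inter> B = {}" "A \<inter> C = {}" "B \<inter> C = {}" by (auto simp: A_def B_def C_def)
    have nA: "\<not> sees v r" if "v \<in> A" for v using that by (simp add: A_def)
    have nB: "\<not> sees v q" if "v \<in> B" for v using that by (simp add: B_def)
    have nC: "\<not> sees v p" if "v \<in> C" for v using that nosee by (auto simp: C_def)
    \<comment> \<open>Both ends see the colour of an edge, so it cannot be a colour that either end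
      misses; this settles the edges within and between parts.\<close>
    have seen: "c {u, v} \<in> {p, q, r} \<and> sees u (c {u, v}) \<and> sees v (c {u, v})"
      if "u \<in> V" "v \<in> V" "u \<noteq> v" for u v
    proof -
      have "c {v, u} = c {u, v}" by (simp add: insert_commute)
      then show ?thesis using that col[OF that] unfolding sees_def by metis
    qed
    have within: "coloured_within c {s, t} X"
      if "X \<subseteq> V" "\<And>v. v \<in> X \<Longrightarrow> \<not> sees v w" "{p, q, r} = {s, t, w}" for X s t w
      unfolding coloured_within_def
    proof (intro ballI impI)
      fix u v assume uv: "u \<in> X" "v \<in> X" "u \<noteq> v"
      then have "c {u, v} \<in> {s, t, w}" "sees u (c {u, v})" using seen[of u v] that(1,3) by auto
      then show "c {u, v} \<in> {s, t}" using that(2)[OF uv(1)] by auto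
    qed
    have between: "joined c s X Y"
      if "X \<subseteq> V" "Y \<subseteq> V" "X \<inter> Y = {}" "\<And>v. v \<in> X \<Longrightarrow> \<not> sees v w" "\<And>v. v \<in> Y \<Longrightarrow> \<not> sees v t"
        "{p, q, r} = {s, t, w}" for X Y s t w
      unfolding joined_def
    proof (intro conjI ballI)
      fix u v assume uv: "u \<in> X" "v \<in> Y"
      then have "c {u, v} \<in> {s, t, w}" "sees u (c {u, v})" "sees v (c {u, v})"
        using seen[of u v] that(1-3,6) by auto
      then show "c {u, v} = s" using that(4)[OF uv(1)] that(5)[OF uv(2)] by auto
    qed (rule that(3))
    have sub: "A \<subseteq> V" "B \<subseteq> V" "C \<subseteq> V" using V by auto
    have cA: "coloured_within c {p, q} A" by (rule within[OF sub(1) nA]) auto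
    have cB: "coloured_within c {p, r} B" by (rule within[OF sub(2) nB]) auto
    have cC: "coloured_within c {q, r} C" by (rule within[OF sub(3) nC]) auto
    have J: "joined c p A B" "joined c q A C" "joined c r B C"
      subgoal by (rule between[OF sub(1,2) disj(1) nA nB]) auto
      subgoal by (rule between[OF sub(1,3) disj(2) nA nC]) auto
      subgoal by (rule between[OF sub(2,3) disj(3) nB nC]) auto
      done
    \<comment> \<open>If only one part were nonempty, its missing colour would not occur at all,
      contrary to exactness.\<close>
    have ne: "\<not> (A = {} \<and> B = {})" "\<not> (A = {} \<and> C = {})" "\<not> (B = {} \<and> C = {})"
    proof -
      have "\<exists>u\<in>V. sees u s" if "s \<in> {p, q, r}" for s
      proof -
        have "s \<in> c ` edges (complete_graph m)" using pqr(1) that by simp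
        then obtain e where e: "e \<in> edges (complete_graph m)" "c e = s" by blast
        from e(1) obtain u v where "e = {u, v}" "u < m" "v < m" "u \<noteq> v" by (rule edge_complete_graphE)
        then have "u \<in> V" "v \<in> V" "v \<noteq> u" "c {u, v} = s" using e(2) by (auto simp: V_def)
        then show ?thesis unfolding sees_def by blast
      qed
      from this[of p] this[of q] this[of r]
      have "\<exists>u\<in>V. sees u p" "\<exists>u\<in>V. sees u q" "\<exists>u\<in>V. sees u r" by simp_all
      then show "\<not> (A = {} \<and> B = {})" "\<not> (A = {} \<and> C = {})" "\<not> (B = {} \<and> C = {})"
        unfolding V using nA nB nC by blast+
    qed
    have "card V = card A + card B + card C"
      using V fin disj by (simp add: card_Un_disjoint Int_Un_distrib2)
    then have card: "2 * n + n div 2 \<le> card A + card B + card C" using m by (simp add: V_def)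
    have "\<exists>s. has_kipas (adj c s) V n"
    proof (cases "A = {} \<or> B = {} \<or> C = {}")
      case False
      then show ?thesis using three_parts[OF fin _ _ _ J cA cB cC n card] V by simp
    next
      case True
      then consider "A = {}" "B \<noteq> {}" "C \<noteq> {}" | "B = {}" "A \<noteq> {}" "C \<noteq> {}" | "C = {}" "A \<noteq> {}" "B \<noteq> {}"
        using ne by blast
      then show ?thesis
      proof cases
        case 1
        have "V = B \<union> C" "2 * n + n div 2 \<le> card B + card C" using V card 1(1) by simp_all
        then show ?thesis using two_parts[OF fin(2,3) 1(2,3) J(3) coloured_within_sym[OF cB] coloured_within_sym[OF cC] n] by simp
      next
        case 2
        have "V = A \<union> C" "2 * n + n div 2 \<le> card A + card C" using V card 2(1) by simp_all
        then show ?thesis using two_parts[OF fin(1,3) 2(2,3) J(2) coloured_within_sym[OF cA] cC n] by simp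
      next
        case 3
        have "V = A \<union> B" "2 * n + n div 2 \<le> card A + card B" using V card 3(1) by simp_all
        then show ?thesis using two_parts[OF fin(1,2) 3(2,3) J(1) cA cB n] by simp
      qed
    qed
    then show False using no by (simp add: V_def)
  qed
qed

section \<open>The lower bound\<close>

text \<open>Three consecutive numbers contain exactly one from each residue class.\<close>

lemma card_residue_class_mult_3:
  fixes a i k :: nat
  assumes "i < 3"
  shows "card {x \<in> {a..<a + 3 * k}. x mod 3 = i} = k"
proof (induction k)
  case (Suc k)
  let ?S = "\<lambda>k. {x \<in> {a..<a + 3 * k}. x mod 3 = i}"
  define s where "s = a + 3 * k"
  have "\<exists>z\<in>{s, Suc s, Suc (Suc s)}. z mod 3 = i \<and> (\<forall>y\<in>{s, Suc s, Suc (Suc s)}. y mod 3 = i \<longrightarrow> y = z)"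
  proof -
    have "s mod 3 < 3" by simp
    then consider "s mod 3 = 0" | "s mod 3 = 1" | "s mod 3 = 2" by linarith
    then show ?thesis
    proof cases
      case 1
      then have "Suc s mod 3 = 1" "Suc (Suc s) mod 3 = 2" by (simp_all add: mod_Suc)
      then show ?thesis using 1 assms by (cases "i = 0"; cases "i = 1") auto
    next
      case 2
      then have "Suc s mod 3 = 2" "Suc (Suc s) mod 3 = 0" by (simp_all add: mod_Suc)
      then show ?thesis using 2 assms by (cases "i = 0"; cases "i = 1") auto
    next
      case 3
      then have "Suc s mod 3 = 0" "Suc (Suc s) mod 3 = 1" by (simp_all add: mod_Suc)
      then show ?thesis using 3 assms by (cases "i = 0"; cases "i = 1") auto
    qed
  qed
  then obtain z where z: "z \<in> {s, Suc s, Suc (Suc s)}" "z mod 3 = i"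
    "\<And>y. y \<in> {s, Suc s, Suc (Suc s)} \<Longrightarrow> y mod 3 = i \<Longrightarrow> y = z"
    by blast
  have "?S (Suc k) = insert z (?S k)"
  proof (intro set_eqI iffI)
    fix x assume x: "x \<in> ?S (Suc k)"
    show "x \<in> insert z (?S k)"
    proof (cases "x < a + 3 * k")
      case False
      then have "x \<in> {s, Suc s, Suc (Suc s)}" using x by (auto simp: s_def)
      then show ?thesis using z(3) x by blast
    qed (use x in auto)
  qed (use z(1,2) in \<open>auto simp: s_def\<close>)
  moreover have "z \<notin> ?S k" using z(1) by (auto simp: s_def)
  ultimately show ?case using Suc by simp
qed simp

text \<open>The interval length is rounded down and up to a multiple of 3.\<close>

lemma card_residue_class_3:
  fixes a b i :: nat
  assumes "i < 3"
  shows "b div 3 \<le> card {x \<in> {a..<a + b}. x mod 3 = i}" "card {x \<in> {a..<a + b}. x mod 3 = i} \<le> (b + 2) div 3"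
proof -
  have "card {x \<in> {a..<a + 3 * (b div 3)}. x mod 3 = i} \<le> card {x \<in> {a..<a + b}. x mod 3 = i}"
    by (rule card_mono) auto
  then show "b div 3 \<le> card {x \<in> {a..<a + b}. x mod 3 = i}"
    unfolding card_residue_class_mult_3[OF assms] .
  have "b \<le> 3 * ((b + 2) div 3)" by presburger
  then have "card {x \<in> {a..<a + b}. x mod 3 = i} \<le> card {x \<in> {a..<a + 3 * ((b + 2) div 3)}. x mod 3 = i}"
    by (intro card_mono) auto
  then show "card {x \<in> {a..<a + b}. x mod 3 = i} \<le> (b + 2) div 3"
    unfolding card_residue_class_mult_3[OF assms] .
qed

lemma length_filter_no_two_consecutive:
  assumes "successively (\<lambda>x y. \<not> (P x \<and> P y)) xs"
  shows "length (filter P xs) \<le> length (filter (\<lambda>x. \<not> P x) xs) + 1"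
proof -
  \<comment> \<open>Strengthened for the induction: the extra one is charged to a first element
    satisfying \<open>P\<close>.\<close>
  have "length (filter P xs) \<le> length (filter (\<lambda>x. \<not> P x) xs) + (if xs \<noteq> [] \<and> P (hd xs) then 1 else 0)"
    using assms by (induction xs rule: induct_list012) (auto split: if_splits)
  then show ?thesis by (auto split: if_splits)
qed

text \<open>Residue classes modulo 3 make the three cliques of colour 1 equal in size up to one vertex.\<close>

definition lower_colouring :: "nat \<Rightarrow> nat set \<Rightarrow> nat" where
  "lower_colouring n e =
     (if e \<subseteq> {..<n} then 2
      else if e \<inter> {..<n} \<noteq> {} \<or> (\<exists>i. \<forall>x\<in>e. x mod 3 = i) then 1 else 3)"

lemma lower_colouring_edge:
  "lower_colouring n {u, v} =
     (if u < n \<and> v < n then 2 else if u < n \<or> v < n \<or> u mod 3 = v mod 3 then 1 else 3)"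
  by (auto simp: lower_colouring_def)

lemma lower_colouring_exact:
  assumes "2 \<le> n" "2 \<le> b"
  shows "exact_edge_coloring 3 (complete_graph (n + b)) (lower_colouring n)"
proof -
  let ?c = "lower_colouring n" and ?E = "edges (complete_graph (n + b))"
  have "?c ` ?E \<subseteq> {1, 2, 3}" by (auto simp: lower_colouring_def)
  moreover have "{0, 1} \<in> ?E" "{0, n} \<in> ?E" "{n, n + 1} \<in> ?E" using assms by auto
  moreover have "?c {0, 1} = 2" "?c {0, n} = 1" using assms by (simp_all add: lower_colouring_edge)
  moreover have "n mod 3 \<noteq> (n + 1) mod 3" by presburger
  then have "?c {n, n + 1} = 3" by (simp add: lower_colouring_edge)
  ultimately have "?c ` ?E = {1, 2, 3}" by (metis (no_types, lifting) imageI insert_subset empty_subsetI subset_antisym)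
  then show ?thesis by (simp add: exact_edge_coloring_def)
qed

text \<open>Vertices below \<open>n\<close> see only the colours 1 and 2, all others only 1 and
  3.\<close>

lemma lower_colouring_no_rainbow_star:
  "\<not> has_rainbow_copy (star_graph 3) (complete_graph m) (lower_colouring n)"
proof
  assume "has_rainbow_copy (star_graph 3) (complete_graph m) (lower_colouring n)"
  then show False
    by (rule rainbow_starE) (auto simp: lower_colouring_edge split: if_splits)
qed

text \<open>The first bound on \<open>b\<close> limits the three cliques of colour 1 to
  \<open>n div 2\<close> vertices each, the second limits neighbourhoods in colour 3 to fewer than
  \<open>n\<close>.\<close>

lemma lower_colouring_no_mono_kipas:
  assumes n: "2 \<le> n" and b: "(b + 2) div 3 \<le> n div 2" "b - b div 3 < n"
  shows "\<not> has_monochromatic_copy (kipas n) (complete_graph (n + b)) (lower_colouring n)"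
proof
  let ?c = "lower_colouring n"
  define K where "K i = {x \<in> {n..<n + b}. x mod 3 = i}" for i
  have K: "b div 3 \<le> card (K (i mod 3))" "card (K (i mod 3)) \<le> n div 2" "finite (K i)" for i
    unfolding K_def using card_residue_class_3[where i = "i mod 3" and a = n and b = b] b(1)
    by (simp_all del: atLeastLessThan_iff)
  assume "has_monochromatic_copy (kipas n) (complete_graph (n + b)) ?c"
  then obtain s where "has_kipas (adj ?c s) {..<n + b} n" using mono_kipas_iff n by auto
  then obtain v xs where v: "v < n + b" and xs: "distinct xs" "set xs \<subseteq> nbrs (adj ?c s) {..<n + b} v"
    "successively (adj ?c s) xs" "length xs = n"
    by (auto simp: has_kipas_def has_path_def path_in_def)
  have nb: "x < n + b \<and> x \<noteq> v \<and> ?c {v, x} = s" if "x \<in> set xs" for x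
    using xs(2) that by (auto simp: nbrs_def adj_def)
  have lenK: "n \<le> card X" if "finite X" "set xs \<subseteq> X" for X
    using card_mono[OF that] distinct_card[OF xs(1)] xs(4) by simp
  have ne: "xs \<noteq> []" using xs(4) n by auto
  then have "?c {v, hd xs} = s" using nb by simp
  then have "s = 1 \<or> s = 2 \<or> s = 3" by (auto simp: lower_colouring_edge split: if_splits)
  then show False
  proof (elim disjE)
    assume s: "s = 2"
    have "v < n \<and> x < n" if "x \<in> set xs" for x
      using nb[OF that] s by (auto simp: lower_colouring_edge split: if_splits)
    then have "set xs \<subseteq> {..<n} - {v}" "v < n" using nb hd_in_set[OF ne] by auto
    then show False using lenK[of "{..<n} - {v}"] n by simp
  next
    assume s: "s = 3"
    have "v \<ge> n \<and> x \<ge> n \<and> x mod 3 \<noteq> v mod 3" if "x \<in> set xs" for x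
      using nb[OF that] s by (auto simp: lower_colouring_edge split: if_splits)
    then have "set xs \<subseteq> {n..<n + b} - K (v mod 3)" using nb by (auto simp: K_def)
    then have "n \<le> card ({n..<n + b} - K (v mod 3))" by (intro lenK) auto
    also have "\<dots> = b - card (K (v mod 3))"
      using K(3) by (subst card_Diff_subset) (auto simp: K_def)
    finally show False using K(1)[of v] b(2) by linarith
  next
    assume s: "s = 1"
    show False
    proof (cases "v < n")
      case True
      \<comment> \<open>All colour 1 neighbours of \<open>v\<close> are outside the first
        \<open>n\<close> vertices, where a path in colour 1 stays in one residue class.\<close>
      have big: "x \<ge> n" if "x \<in> set xs" for x
        using nb[OF that] s True by (auto simp: lower_colouring_edge split: if_splits)
      have step: "xs ! i mod 3 = xs ! Suc i mod 3" if "Suc i < n" for i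
      proof -
        have "xs ! i \<in> set xs" "xs ! Suc i \<in> set xs" using that xs(4) by auto
        then have "n \<le> xs ! i" "n \<le> xs ! Suc i" using big by blast+
        moreover have "?c {xs ! i, xs ! Suc i} = 1"
          using successively_nth[OF xs(3), of i] that xs(4) s by (simp add: adj_def)
        ultimately show ?thesis by (auto simp: lower_colouring_edge split: if_splits)
      qed
      have "xs ! i mod 3 = xs ! 0 mod 3" if "i < n" for i
        using that by (induction i) (use step in \<open>auto simp: Suc_lessD\<close>)
      then have "x mod 3 = xs ! 0 mod 3" if "x \<in> set xs" for x
        using that xs(4) by (metis in_set_conv_nth)
      then have "set xs \<subseteq> K (xs ! 0 mod 3)" using big nb by (auto simp: K_def)
      then show False using lenK[OF K(3)] K(2)[of "xs ! 0"] n by fastforce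
    next
      case False
      \<comment> \<open>No two vertices below \<open>n\<close> are adjacent in colour 1, so the path
        has at most one more of them than of the others. At most \<open>n div 2 - 1\<close> others
        are neighbours of \<open>v\<close>, hence the path has fewer than \<open>n\<close>
        vertices.\<close>
      have "successively (\<lambda>x y. \<not> (x < n \<and> y < n)) xs"
        by (rule successively_mono[OF xs(3)]) (auto simp: s adj_def lower_colouring_edge split: if_splits)
      then have le: "length (filter (\<lambda>x. x < n) xs) \<le> length (filter (\<lambda>x. \<not> x < n) xs) + 1"
        by (rule length_filter_no_two_consecutive)
      have vK: "v \<in> K (v mod 3)" using False v by (auto simp: K_def)
      have "set (filter (\<lambda>x. \<not> x < n) xs) \<subseteq> K (v mod 3) - {v}"
      proof
        fix x assume "x \<in> set (filter (\<lambda>x. \<not> x < n) xs)"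
        then have x: "x < n + b" "x \<noteq> v" "n \<le> x" "?c {v, x} = 1" using nb s by auto
        then have "x mod 3 = v mod 3" using False by (simp add: lower_colouring_edge split: if_splits)
        then show "x \<in> K (v mod 3) - {v}" using x by (simp add: K_def)
      qed
      then have "card (set (filter (\<lambda>x. \<not> x < n) xs)) \<le> card (K (v mod 3) - {v})"
        using K(3) by (intro card_mono) auto
      also have "\<dots> = card (K (v mod 3)) - 1" using vK K(3) by simp
      also have "\<dots> \<le> n div 2 - 1" using K(2)[of v] by simp
      finally have "length (filter (\<lambda>x. \<not> x < n) xs) \<le> n div 2 - 1"
        using distinct_card[OF distinct_filter[OF xs(1)], of "\<lambda>x. \<not> x < n"] by simp
      moreover have "length (filter (\<lambda>x. x < n) xs) + length (filter (\<lambda>x. \<not> x < n) xs) = n"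
        using sum_length_filter_compl[of "\<lambda>x. x < n" xs] xs(4) by simp
      ultimately show False using le n by linarith
    qed
  qed
qed

text \<open>The existing bound \<open>M\<close> ensures that the \<open>LEAST\<close> in the
  definition is itself a bound.\<close>

lemma gallai_ramsey_lower:
  assumes "gallai_ramsey_bound k G H M" "exact_edge_coloring k (complete_graph m) c"
    and "\<not> has_rainbow_copy G (complete_graph m) c" "\<not> has_monochromatic_copy H (complete_graph m) c"
  shows "m < gallai_ramsey k G H"
proof (rule ccontr)
  assume "\<not> ?thesis"
  moreover have "gallai_ramsey_bound k G H (gallai_ramsey k G H)"
    using assms(1) unfolding gallai_ramsey_def by (rule LeastI)
  ultimately show False using assms(2-4) unfolding gallai_ramsey_bound_def by (meson not_less)
qed

theorem theorem1p10:
  fixes n :: nat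
  assumes "n \<ge> 5"
  shows "(odd n \<longrightarrow> int (gallai_ramsey 3 (star_graph 3) (kipas n)) = \<lfloor>5 * real n / 2\<rfloor>) \<and>
         (even n \<longrightarrow> \<lfloor>5 * real n / 2\<rfloor> - 1 \<le> int (gallai_ramsey 3 (star_graph 3) (kipas n)) \<and>
                     int (gallai_ramsey 3 (star_graph 3) (kipas n)) \<le> \<lfloor>5 * real n / 2\<rfloor>)"
proof -
  let ?g = "gallai_ramsey 3 (star_graph 3) (kipas n)"
  have bound: "gallai_ramsey_bound 3 (star_graph 3) (kipas n) (2 * n + n div 2)"
    using gallai_ramsey_star_kipas_bound assms by simp
  then have upper: "?g \<le> 2 * n + n div 2" unfolding gallai_ramsey_def by (rule Least_le)
  have lower: "n + b < ?g" if "2 \<le> b" "(b + 2) div 3 \<le> n div 2" "b - b div 3 < n" for b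
    using that assms
    by (intro gallai_ramsey_lower[OF bound lower_colouring_exact lower_colouring_no_rainbow_star
          lower_colouring_no_mono_kipas]) auto
  have "\<lfloor>5 * real n / 2\<rfloor> = int (5 * n div 2)"
    using floor_divide_of_nat_eq[of "5 * n" 2, where ?'a = real] by simp
  also have "5 * n div 2 = 2 * n + n div 2" by presburger
  finally have fl: "\<lfloor>5 * real n / 2\<rfloor> = int (2 * n + n div 2)" .
  show ?thesis
  proof (cases "odd n")
    case True
    then obtain k where k: "n = 2 * k + 1" by (elim oddE)
    \<comment> \<open>Three cliques with \<open>k\<close> vertices each; \<open>n + 3 * k\<close> is
      one less than the upper bound.\<close>
    then have "n + 3 * k < ?g" using assms by (intro lower) auto
    then show ?thesis using upper fl True k by auto
  next
    case False
    then obtain k where k: "n = 2 * k" by blast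
    then obtain j where j: "k = j + 1" using assms by (cases k) auto
    \<comment> \<open>Here \<open>b = 3 * k - 2\<close>. The next value \<open>3 * k - 1\<close>
      would violate \<open>b - b div 3 < n\<close>, so one is lost against the upper bound.\<close>
    then have "n + (3 * j + 1) < ?g" using assms k by (intro lower) auto
    then show ?thesis using upper fl False k j by auto
  qed
qed

end
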